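(* Let $g\in H(\mathbb{D})$ be such that $\log(g')\in\mathcal{B}$, let $\nu$ be an analytic weight and let $\mu$ be an arbitrary weight. Then $T_g: H^{\infty}_\nu\rightarrow H^{\infty}_\mu$ is compact if and only if $$\lim_{t_2\rightarrow1^-}\limsup_{t_1\rightarrow1^-}\sup_{0\leq\theta<2\pi}\mu(t_1)\int_{t_2}^{t_1}\frac{|g'(re^{i\theta})|}{\nu(r)}\,dr=0\,.$$
   Context: $\mathbb{D}$ is the open unit disk and $H(\mathbb{D})$ the space of analytic functions on $\mathbb{D}$. A weight is a non-negative continuous function $\nu$ on $\mathbb{D}$ with $\nu(z)=\nu(|z|)$ for all $z$, which is decreasing in $|z|$; we write $\nu(r)$ for its value at $|z|=r$. For a weight $\nu$, $H^{\infty}_\nu=\{f\in H(\mathbb{D}): \|f\|_{H^\infty_\nu}:=\sup_{z\in\mathbb{D}}\nu(z)|f(z)|<\infty\}$. The Bloch space is $\mathcal{B}=\{f\in H(\mathbb{D}): |f(0)|+\sup_{z}(1-|z|^2)|f'(z)|<\infty\}$; "$\log(g')\in\mathcal{B}$" means $g'$ has no zeros in $\mathbb{D}$ and an analytic branch of $\log g'$ belongs to $\mathcal{B}$. A weight $\nu$ is analytic if $\nu(z)=1/F(|z|)$ for some $F\in H(\mathbb{D})$ with $|F(z)|\leq F(|z|)$ for all $z$. For $g\in H(\mathbb{D})$, $(T_gf)(z)=\int_0^z f(\omega)g'(\omega)\,d\omega$. *)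

theory Defs
  imports "HOL-Complex_Analysis.Complex_Analysis"
begin

abbreviation unit_disc :: "complex set" where "unit_disc \<equiv> ball 0 1"

definition weight :: "(complex \<Rightarrow> real) \<Rightarrow> bool" where
  "weight \<nu> \<longleftrightarrow> continuous_on unit_disc \<nu>
     \<and> (\<forall>z\<in>unit_disc. \<nu> z \<ge> 0)
     \<and> (\<forall>z\<in>unit_disc. \<nu> z = \<nu> (complex_of_real (norm z)))
     \<and> (\<forall>z\<in>unit_disc. \<forall>w\<in>unit_disc. norm z \<le> norm w \<longrightarrow> \<nu> w \<le> \<nu> z)"

definition analytic_weight :: "(complex \<Rightarrow> real) \<Rightarrow> bool" where
  "analytic_weight \<nu> \<longleftrightarrow> (\<exists>F. F holomorphic_on unit_disc
     \<and> (\<forall>z\<in>unit_disc. complex_of_real (\<nu> z) * F (complex_of_real (norm z)) = 1)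
     \<and> (\<forall>z\<in>unit_disc. cmod (F z) \<le> Re (F (complex_of_real (norm z)))))"

definition Hinf :: "(complex \<Rightarrow> real) \<Rightarrow> (complex \<Rightarrow> complex) set" where
  "Hinf \<nu> = {f. f holomorphic_on unit_disc \<and> bdd_above ((\<lambda>z. \<nu> z * cmod (f z)) ` unit_disc)}"

definition Hinf_norm :: "(complex \<Rightarrow> real) \<Rightarrow> (complex \<Rightarrow> complex) \<Rightarrow> real" where
  "Hinf_norm \<nu> f = (SUP z\<in>unit_disc. \<nu> z * cmod (f z))"

definition bloch :: "(complex \<Rightarrow> complex) set" where
  "bloch = {h. h holomorphic_on unit_disc
     \<and> (\<exists>C. \<forall>z\<in>unit_disc. (1 - (norm z)\<^sup>2) * cmod (deriv h z) \<le> C)}"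

definition log_deriv_bloch :: "(complex \<Rightarrow> complex) \<Rightarrow> bool" where
  "log_deriv_bloch g \<longleftrightarrow> (\<forall>z\<in>unit_disc. deriv g z \<noteq> 0)
     \<and> (\<exists>L\<in>bloch. \<forall>z\<in>unit_disc. exp (L z) = deriv g z)"

definition Tg :: "(complex \<Rightarrow> complex) \<Rightarrow> (complex \<Rightarrow> complex) \<Rightarrow> complex \<Rightarrow> complex" where
  "Tg g f z = contour_integral (linepath 0 z) (\<lambda>w. f w * deriv g w)"

definition Tg_compact :: "(complex \<Rightarrow> complex) \<Rightarrow> (complex \<Rightarrow> real) \<Rightarrow> (complex \<Rightarrow> real) \<Rightarrow> bool" where
  "Tg_compact g \<nu> \<mu> \<longleftrightarrow> (\<forall>f\<in>Hinf \<nu>. Tg g f \<in> Hinf \<mu>)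
     \<and> (\<forall>fs :: nat \<Rightarrow> complex \<Rightarrow> complex. \<forall>B.
          (\<forall>n. fs n \<in> Hinf \<nu> \<and> Hinf_norm \<nu> (fs n) \<le> B) \<longrightarrow>
          (\<exists>r h. strict_mono r \<and> h \<in> Hinf \<mu> \<and>
             (\<lambda>k. Hinf_norm \<mu> (\<lambda>z. Tg g (fs (r k)) z - h z)) \<longlonglongrightarrow> 0))"

definition Phi :: "(complex \<Rightarrow> complex) \<Rightarrow> (complex \<Rightarrow> real) \<Rightarrow> (complex \<Rightarrow> real) \<Rightarrow> real \<Rightarrow> real \<Rightarrow> real" where
  "Phi g \<nu> \<mu> t1 t2 = (SUP \<theta>\<in>{0..<2*pi}.
      \<mu> (complex_of_real t1) *
      integral {t2..t1} (\<lambda>r. cmod (deriv g (complex_of_real r * cis \<theta>)) / \<nu> (complex_of_real r)))"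

end

theory Submission
  imports Defs
begin

text \<open>
  Sufficiency: by Montel's theorem a norm-bounded sequence has a locally uniformly convergent
  subsequence, and the part of the radial integral beyond \<open>t\<^sub>2\<close> is controlled by \<^const>\<open>Phi\<close>.

  Necessity: in the hyperbolic coordinate \<open>log ((1 + r) / (1 - r))\<close> the argument of \<open>g'\<close> along a
  radius is Lipschitz, because \<open>log g'\<close> is a Bloch function. Its convolution with a narrow Gaussian is
  an entire function \<open>h\<close> that is uniformly close to it on the radius and has bounded imaginary part on
  the strip \<open>\<bar>Im \<zeta>\<bar> \<le> \<pi> / 2\<close>, the image of the disc. So \<open>exp (- \<i> h)\<close> is a bounded analytic
  function on the disc that nearly cancels the argument of \<open>g'\<close> on the radius. Multiplying it by the
  rotated \<open>F = 1 / \<nu>\<close> and by \<open>z\<^sup>n\<close> gives functions bounded in \<open>H\<^sup>\<infinity>\<^sub>\<nu>\<close> and tending to 0 locally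
  uniformly, whose images under \<open>T\<^sub>g\<close> must then tend to 0 in norm if \<open>T\<^sub>g\<close> is compact.
\<close>

subsection \<open>Approximation of Lipschitz functions by entire functions on a strip\<close>

text \<open>Up to scaling, \<open>E\<close> is the error function: a primitive of exp(-z^2)
  vanishing at 0, hence real on the real axis and odd there because the integrand is even. It serves
  as a smooth sign function: \<open>e (b * x) / l\<close> tends to the sign of x as \<open>b\<close>
  grows. The last clause bounds the tail well enough to make \<open>l - e\<close> integrable over
  the half line.\<close>

lemma gaussian_primitive:
  obtains E :: "complex \<Rightarrow> complex" and e :: "real \<Rightarrow> real" and l :: real
  where "\<And>z. (E has_field_derivative exp (- z\<^sup>2)) (at z)"
    and "\<And>x. E (of_real x) = of_real (e x)"
    and "\<And>x. (e has_real_derivative exp (- x\<^sup>2)) (at x)"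
    and "\<And>x. e (- x) = - e x"
    and "0 < l" and "\<And>x. e x \<le> l"
    and "\<And>x. 0 \<le> x \<Longrightarrow> x * (l - e x) \<le> exp (- x\<^sup>2) / 2"
proof -
  have "(\<lambda>z::complex. exp (- z\<^sup>2)) holomorphic_on UNIV"
    by (intro holomorphic_intros)
  then obtain E0 :: "complex \<Rightarrow> complex" where E0: "\<And>z. (E0 has_field_derivative exp (- z\<^sup>2)) (at z)"
    using holomorphic_convex_primitive'[of UNIV "\<lambda>z. exp (- z\<^sup>2)"] by auto
  define E where "E = (\<lambda>z. E0 z - E0 0)"
  define e where "e = (\<lambda>x::real. Re (E (of_real x)))"
  have E: "(E has_field_derivative exp (- z\<^sup>2)) (at z)" for z
    unfolding E_def by (auto intro!: derivative_eq_intros E0)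
  have vd: "((\<lambda>x. E (of_real x)) has_vector_derivative of_real (exp (- x\<^sup>2))) (at x)" for x
    using has_vector_derivative_real_field[OF E[of "of_real x"]] by (simp flip: exp_of_real)
  have de: "(e has_real_derivative exp (- x\<^sup>2)) (at x)" for x
    using bounded_linear.has_vector_derivative[OF bounded_linear_Re vd[of x]] unfolding e_def
    by (simp add: has_real_derivative_iff_has_vector_derivative)
  have "((\<lambda>x. Im (E (of_real x))) has_real_derivative 0) (at x)" for x
    using bounded_linear.has_vector_derivative[OF bounded_linear_Im vd[of x]]
    by (simp add: has_real_derivative_iff_has_vector_derivative)
  then have "Im (E (of_real x)) = Im (E (of_real 0))" for x
    using DERIV_isconst_all[of "\<lambda>x. Im (E (of_real x))" x 0] by blast
  then have Ee: "E (of_real x) = of_real (e x)" for x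
    by (simp add: complex_eq_iff e_def E_def)
  have "((\<lambda>x. e x + e (- x)) has_real_derivative 0) (at x)" for x
    by (rule derivative_eq_intros DERIV_chain2[OF de] refl de | simp)+
  then have "e x + e (- x) = e 0 + e (- 0)" for x
    using DERIV_isconst_all[of "\<lambda>x. e x + e (- x)" x 0] by blast
  moreover have "e 0 = 0" by (simp add: e_def E_def)
  ultimately have odd: "e (- x) = - e x" for x
    by (metis add_0 add_eq_0_iff minus_zero)
  have mono: "e x < e y" if "x < y" for x y
    using that by (rule DERIV_pos_imp_increasing) (use de in force)
  have key: "x * (e y - e x) \<le> (exp (- x\<^sup>2) - exp (- y\<^sup>2)) / 2" if "x \<le> y" for x y
  proof -
    \<comment> \<open>In integral form: for t between x and y, x exp(-t^2) is at most t exp(-t^2),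
      and the latter has the explicit primitive - exp(-t^2) / 2.\<close>
    have "x * e y + exp (- y\<^sup>2) / 2 \<le> x * e x + exp (- x\<^sup>2) / 2"
    proof (rule DERIV_nonpos_imp_nonincreasing[OF that])
      fix z assume z: "x \<le> z" "z \<le> y"
      have "((\<lambda>z. x * e z + exp (- z\<^sup>2) / 2) has_real_derivative (x - z) * exp (- z\<^sup>2)) (at z)"
        by (rule derivative_eq_intros de refl | simp add: algebra_simps)+
      moreover have "(x - z) * exp (- z\<^sup>2) \<le> 0"
        using z by (simp add: mult_le_0_iff)
      ultimately show "\<exists>d. ((\<lambda>z. x * e z + exp (- z\<^sup>2) / 2) has_real_derivative d) (at z) \<and> d \<le> 0"
        by blast
    qed
    then show ?thesis by (simp add: algebra_simps diff_divide_distrib)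
  qed
  \<comment> \<open>The tail estimate started at 1 bounds \<open>e\<close>, so its supremum
    \<open>l\<close> exists.\<close>
  have bdd: "e x \<le> e 1 + 1" for x
  proof (cases "x \<le> 1")
    case True
    then show ?thesis using mono[of x 1] by (cases "x = 1") auto
  next
    case False
    then have "e x - e 1 \<le> (exp (- 1\<^sup>2) - exp (- x\<^sup>2)) / 2" using key[of 1 x] by simp
    also have "\<dots> \<le> 1"
    proof -
      have "(a - b) / 2 \<le> 1" if "a \<le> 1" "0 \<le> b" for a b :: real using that by simp
      from this[of "exp (- 1\<^sup>2)" "exp (- x\<^sup>2)"] show ?thesis by simp
    qed
    finally show ?thesis by simp
  qed
  define l where "l = (SUP x. e x)"
  have bda: "bdd_above (range e)" using bdd by (auto intro!: bdd_aboveI[of _ "e 1 + 1"])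
  have le: "e x \<le> l" for x unfolding l_def by (rule cSUP_upper[OF _ bda]) simp
  have "0 < l" using mono[of 0 1] le[of 1] odd[of 0] by simp
  moreover have "x * (l - e x) \<le> exp (- x\<^sup>2) / 2" if "0 \<le> x" for x
  proof (cases "x = 0")
    case False
    with that have x: "x > 0" by simp
    \<comment> \<open>This bound is free of y; passing to the supremum over y replaces a limit at
      infinity.\<close>
    have "e y \<le> e x + exp (- x\<^sup>2) / (2 * x)" for y
    proof (cases "x \<le> y")
      case True
      then have "x * (e y - e x) \<le> exp (- x\<^sup>2) / 2" 
        by (rule order_trans[OF key]) (simp add: divide_right_mono)
      then show ?thesis using x by (simp add: field_simps)
    next
      case False
      then have "e y \<le> e x" using mono[of y x] by simp
      then show ?thesis using x by (simp add: add_increasing2)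
    qed
    then have "l \<le> e x + exp (- x\<^sup>2) / (2 * x)"
      unfolding l_def by (intro cSUP_least) auto
    then show ?thesis using x by (simp add: field_simps)
  qed simp
  ultimately show ?thesis using that[OF E Ee de odd _ le] by blast
qed

lemma integral_weighted_bound:
  fixes v w :: "real \<Rightarrow> real"
  assumes v: "continuous_on {a..b} v" "\<And>t. t \<in> {a..b} \<Longrightarrow> \<bar>v t\<bar> \<le> C"
    and w: "(w has_integral J) {a..b}" "continuous_on {a..b} w" "\<And>t. t \<in> {a..b} \<Longrightarrow> 0 \<le> w t"
  shows "\<bar>integral {a..b} (\<lambda>t. v t * w t)\<bar> \<le> C * J"
proof -
  have "norm (integral {a..b} (\<lambda>t. v t * w t)) \<le> integral {a..b} (\<lambda>t. C * w t)"
  proof (rule integral_norm_bound_integral)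
    show "(\<lambda>t. v t * w t) integrable_on {a..b}"
      by (intro integrable_continuous_real continuous_intros v w)
    show "(\<lambda>t. C * w t) integrable_on {a..b}"
      by (intro integrable_continuous_real continuous_intros v w)
    show "norm (v t * w t) \<le> C * w t" if "t \<in> {a..b}" for t
      using v(2)[OF that] w(3)[OF that] by (simp add: abs_mult mult_right_mono)
  qed
  also have "\<dots> = C * J" using w(1) by (simp add: integral_unique)
  finally show ?thesis by simp
qed

text \<open>Since \<open>E (b * (s - t)) / (2 * l)\<close> is close to half the sign of
  \<open>s - t\<close>, integrating \<open>v t\<close> against it gives nearly half the difference
  of the integrals of \<open>v\<close> over {0..s} and {s..S}, which is the integral over {0..s} up
  to a constant \<open>c\<close>. The derivative of the result is a Gaussian average of
  \<open>v\<close>, which stays bounded on a strip. \<open>M\<close> depends on \<open>C\<close> and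
  \<open>\<epsilon>\<close> only; uniformity in \<open>S\<close> is what later allows radii
  arbitrarily close to 1.\<close>

lemma lipschitz_approx_strip:
  fixes C \<epsilon> :: real
  assumes "0 \<le> C" "0 < \<epsilon>"
  shows "\<exists>M. \<forall>S v. 0 \<le> S \<longrightarrow> continuous_on {0..S} v \<longrightarrow> (\<forall>t\<in>{0..S}. \<bar>v t\<bar> \<le> C) \<longrightarrow>
     (\<exists>h c. h holomorphic_on UNIV
       \<and> (\<forall>s\<in>{0..S}. Im (h (of_real s)) = 0 \<and> \<bar>Re (h (of_real s)) - c - integral {0..s} v\<bar> \<le> \<epsilon>)
       \<and> (\<forall>z. \<bar>Im z\<bar> \<le> pi / 2 \<longrightarrow> \<bar>Im (h z)\<bar> \<le> M))"
proof -
  obtain E :: "complex \<Rightarrow> complex" and e l where E: "\<And>z. (E has_field_derivative exp (- z\<^sup>2)) (at z)"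
    and Ee: "\<And>x. E (of_real x) = of_real (e x)"
    and de: "\<And>x. (e has_real_derivative exp (- x\<^sup>2)) (at x)"
    and odd: "\<And>x. e (- x) = - e x"
    and l: "0 < l" and le: "\<And>x. e x \<le> l"
    and tail: "\<And>x. 0 \<le> x \<Longrightarrow> x * (l - e x) \<le> exp (- x\<^sup>2) / 2"
    using gaussian_primitive by blast
  note E' = DERIV_chain2[OF E] and de' = DERIV_chain2[OF de]
  have cE: "continuous_on A (\<lambda>x. E (f x))" if "continuous_on A f" for A :: "'x::topological_space set" and f
    by (rule continuous_on_compose2[OF _ that, of UNIV])
      (use E DERIV_isCont in \<open>auto intro!: continuous_at_imp_continuous_on\<close>)
  have ce: "continuous_on A (\<lambda>x. e (f x))" if "continuous_on A f" for A :: "'x::topological_space set" and f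
    by (rule continuous_on_compose2[OF _ that, of UNIV])
      (use de DERIV_isCont in \<open>auto intro!: continuous_at_imp_continuous_on\<close>)
  \<comment> \<open>Chosen so that the error \<open>C / (2 * l * b)\<close> found below equals C /
    (C + 1) times \<open>\<epsilon>\<close>; the summand 1 keeps \<open>b\<close> positive when
    \<open>C\<close> is 0.\<close>
  define b where "b = (C + 1) / (2 * l * \<epsilon>)"
  have b: "b > 0" using assms l by (simp add: b_def)
  have be: "C / (2 * l * b) \<le> \<epsilon>"
  proof -
    have "2 * l * b = (C + 1) / \<epsilon>" using assms l by (simp add: b_def)
    then have "C / (2 * l * b) = C / (C + 1) * \<epsilon>" by (metis divide_divide_eq_right times_divide_eq_left)
    also have "\<dots> \<le> 1 * \<epsilon>" using assms by (intro mult_right_mono) auto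
    finally show ?thesis by simp
  qed
  \<comment> \<open>The primitive of \<open>l - e\<close> vanishing at 0, obtained by parts. By the
    tail estimate it never exceeds 1/2 on the half line, so the smoothing error does not grow with
    \<open>S\<close>.\<close>
  define W where "W = (\<lambda>x. x * (l - e x) + (1 - exp (- x\<^sup>2)) / 2)"
  have dW: "(W has_real_derivative (l - e x)) (at x)" for x
    unfolding W_def by (rule derivative_eq_intros de refl | simp add: algebra_simps)+
  note dW' = DERIV_chain2[OF dW]
  have W0: "W 0 = 0" by (simp add: W_def)
  have W1: "W x \<le> 1 / 2" if "0 \<le> x" for x using tail[OF that] by (simp add: W_def diff_divide_distrib)
  \<comment> \<open>A bound for the derivative of \<open>h\<close> on the strip: at height at most
    pi/2 the modulus of the Gaussian exceeds its value at the real part by a factor of at most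
    exp(b^2 pi^2 / 4).\<close>
  define D where "D = C * exp (b\<^sup>2 * pi\<^sup>2 / 4)"
  have D: "D \<ge> 0" using assms by (simp add: D_def)
  show ?thesis
  proof (intro exI[of _ "D * (pi / 2)"] allI impI)
    fix S :: real and v :: "real \<Rightarrow> real"
    assume S: "0 \<le> S" and cv: "continuous_on {0..S} v" and "\<forall>t\<in>{0..S}. \<bar>v t\<bar> \<le> C"
    then have vC: "\<And>t. t \<in> {0..S} \<Longrightarrow> \<bar>v t\<bar> \<le> C" by blast
    define h where "h = (\<lambda>z::complex. integral (cbox 0 S) (\<lambda>t. of_real (v t / (2 * l)) * E (of_real b * (z - of_real t))))"
    define h' where "h' = (\<lambda>z::complex. integral (cbox 0 S) (\<lambda>t. of_real (v t / (2 * l) * b) * exp (- (of_real b * (z - of_real t))\<^sup>2)))"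
    define c where "c = - integral {0..S} v / 2"
    have dh: "(h has_field_derivative h' z) (at z)" for z
    proof -
      have "(h has_field_derivative h' z) (at z within UNIV)"
        unfolding h_def h'_def
      proof (rule leibniz_rule_field_derivative)
        show "((\<lambda>z. of_real (v t / (2 * l)) * E (of_real b * (z - of_real t))) has_field_derivative
            of_real (v t / (2 * l) * b) * exp (- (of_real b * (z - of_real t))\<^sup>2)) (at z within UNIV)" for z t
          by (rule derivative_eq_intros E' refl | simp add: algebra_simps)+
        show "(\<lambda>t. of_real (v t / (2 * l)) * E (of_real b * (z - of_real t))) integrable_on cbox 0 S" for z
          unfolding cbox_interval using l
          by (intro integrable_continuous_real continuous_intros cv cE) auto
        have cv2: "continuous_on (UNIV \<times> {0..S}) (\<lambda>x::complex\<times>real. v (snd x))"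
          by (rule continuous_on_compose2[OF cv]) (auto intro!: continuous_intros)
        show "continuous_on (UNIV \<times> cbox 0 S)
            (\<lambda>(z, t). of_real (v t / (2 * l) * b) * exp (- (of_real b * (z - of_real t))\<^sup>2) :: complex)"
          unfolding cbox_interval split_beta using l
          by (intro continuous_intros cv2) auto
      qed auto
      then show ?thesis by simp
    qed
    have hh: "h holomorphic_on UNIV"
      using dh by (auto simp: holomorphic_on_def field_differentiable_def)
    have hreal: "h (of_real s) = of_real (integral {0..S} (\<lambda>t. v t / (2 * l) * e (b * (s - t))))" for s
    proof -
      have "h (of_real s) = integral {0..S} (\<lambda>t. of_real (v t / (2 * l) * e (b * (s - t))))"
        unfolding h_def cbox_interval
        by (rule integral_cong) (metis Ee of_real_diff of_real_mult)
      also have "\<dots> = of_real (integral {0..S} (\<lambda>t. v t / (2 * l) * e (b * (s - t))))"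
        using l by (intro integral_linear[OF _ bounded_linear_of_real, unfolded o_def] integrable_continuous_real
            continuous_intros cv ce) auto
      finally show ?thesis .
    qed
    \<comment> \<open>Split the integral at s. Replacing the kernel by its limit \<open>l\<close> to
      the left of s and \<open>- l\<close> to the right gives the main term; \<open>J1\<close> and
      \<open>J2\<close> are the two remainders, each at most \<open>C / (2 * b)\<close>.\<close>
    have err: "\<bar>Re (h (of_real s)) - c - integral {0..s} v\<bar> \<le> \<epsilon>" if s: "s \<in> {0..S}" for s
    proof -
      have cv1: "continuous_on {0..s} v" and cv2: "continuous_on {s..S} v"
        using s by (auto intro: continuous_on_subset[OF cv])
      define J1 where "J1 = integral {0..s} (\<lambda>t. v t * (l - e (b * (s - t))))"
      define J2 where "J2 = integral {s..S} (\<lambda>t. v t * (l - e (b * (t - s))))"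
      have i1: "integral {0..s} (\<lambda>t. v t * e (b * (s - t))) = l * integral {0..s} v - J1"
      proof -
        have "l * integral {0..s} v - J1 = integral {0..s} (\<lambda>t. l * v t - v t * (l - e (b * (s - t))))"
          unfolding J1_def
          by (subst integral_diff) (auto intro!: integrable_continuous_real continuous_intros cv1 ce)
        then show ?thesis by (simp add: algebra_simps)
      qed
      have i2: "integral {s..S} (\<lambda>t. v t * e (b * (s - t))) = J2 - l * integral {s..S} v"
      proof -
        have "J2 - l * integral {s..S} v = integral {s..S} (\<lambda>t. v t * (l - e (b * (t - s))) - l * v t)"
          unfolding J2_def
          by (subst integral_diff) (auto intro!: integrable_continuous_real continuous_intros cv2 ce)
        also have "\<dots> = integral {s..S} (\<lambda>t. v t * e (b * (s - t)))"
        proof (rule integral_cong)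
          fix t
          have "e (b * (s - t)) = - e (b * (t - s))" using odd[of "b * (t - s)"] by (simp add: algebra_simps)
          then show "v t * (l - e (b * (t - s))) - l * v t = v t * e (b * (s - t))" by (simp add: algebra_simps)
        qed
        finally show ?thesis by simp
      qed
      have h1: "((\<lambda>t. l - e (b * (s - t))) has_integral W (b * s) / b) {0..s}"
      proof -
        have "((\<lambda>t. l - e (b * (s - t))) has_integral (- W (b * (s - s)) / b - (- W (b * (s - 0)) / b))) {0..s}"
          using s b by (intro fundamental_theorem_of_calculus)
            (auto intro!: derivative_eq_intros dW' simp flip: has_real_derivative_iff_has_vector_derivative)
        then show ?thesis by (simp add: W0)
      qed
      have h2: "((\<lambda>t. l - e (b * (t - s))) has_integral W (b * (S - s)) / b) {s..S}"
      proof -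
        have "((\<lambda>t. l - e (b * (t - s))) has_integral (W (b * (S - s)) / b - W (b * (s - s)) / b)) {s..S}"
          using s b by (intro fundamental_theorem_of_calculus)
            (auto intro!: derivative_eq_intros dW' simp flip: has_real_derivative_iff_has_vector_derivative)
        then show ?thesis by (simp add: W0)
      qed
      have "\<bar>J1\<bar> \<le> C * (W (b * s) / b)" unfolding J1_def
        by (rule integral_weighted_bound[OF cv1 _ h1])
          (use s vC le in \<open>auto intro!: continuous_intros ce simp: diff_ge_0_iff_ge\<close>)
      also have "\<dots> \<le> C * (1 / 2 / b)"
        using s b assms W1[of "b * s"] by (intro mult_left_mono divide_right_mono) auto
      finally have J1: "\<bar>J1\<bar> \<le> C / (2 * b)" by simp
      have "\<bar>J2\<bar> \<le> C * (W (b * (S - s)) / b)" unfolding J2_def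
        by (rule integral_weighted_bound[OF cv2 _ h2])
          (use s vC le in \<open>auto intro!: continuous_intros ce simp: diff_ge_0_iff_ge\<close>)
      also have "\<dots> \<le> C * (1 / 2 / b)"
        using s b assms W1[of "b * (S - s)"] by (intro mult_left_mono divide_right_mono) auto
      finally have J2: "\<bar>J2\<bar> \<le> C / (2 * b)" by simp
      have "integral {0..S} (\<lambda>t. v t / (2 * l) * e (b * (s - t)))
          = integral {0..S} (\<lambda>t. 1 / (2 * l) * (v t * e (b * (s - t))))" by (simp add: algebra_simps)
      also have "\<dots> = 1 / (2 * l) * integral {0..S} (\<lambda>t. v t * e (b * (s - t)))" by (rule integral_mult_right)
      also have "integral {0..S} (\<lambda>t. v t * e (b * (s - t)))
          = integral {0..s} (\<lambda>t. v t * e (b * (s - t))) + integral {s..S} (\<lambda>t. v t * e (b * (s - t)))"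
        using s by (intro Henstock_Kurzweil_Integration.integral_combine[symmetric])
          (auto intro!: integrable_continuous_real continuous_intros cv ce)
      finally have "Re (h (of_real s)) = 1 / (2 * l) * (l * integral {0..s} v - J1 + (J2 - l * integral {s..S} v))"
        by (simp add: hreal i1 i2)
      moreover have "integral {0..S} v = integral {0..s} v + integral {s..S} v"
        using s by (intro Henstock_Kurzweil_Integration.integral_combine[symmetric])
          (auto intro!: integrable_continuous_real cv)
      ultimately have "Re (h (of_real s)) - c - integral {0..s} v = (J2 - J1) / (2 * l)"
        using l by (simp add: c_def field_simps)
      also have "\<bar>\<dots>\<bar> \<le> (C / b) / (2 * l)"
      proof -
        have "\<bar>J2 - J1\<bar> \<le> C / b" using J1 J2 by (simp add: field_simps)
        then have "\<bar>J2 - J1\<bar> / (2 * l) \<le> (C / b) / (2 * l)" using l by (intro divide_right_mono) auto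
        then show ?thesis using l by (simp add: abs_divide)
      qed
      also have "\<dots> \<le> \<epsilon>" using be by (simp add: field_simps)
      finally show ?thesis .
    qed
    have h'b: "norm (h' z) \<le> D" if z: "\<bar>Im z\<bar> \<le> pi / 2" for z
    proof -
      have kern: "norm (exp (- (of_real b * (z - of_real t))\<^sup>2)) \<le> exp (b\<^sup>2 * pi\<^sup>2 / 4) * exp (- (b * (Re z - t))\<^sup>2)" for t
      proof -
        have "(Im z)\<^sup>2 \<le> (pi / 2)\<^sup>2" using z pi_ge_zero by (simp add: abs_le_square_iff flip: abs_le_square_iff)
        then have "b\<^sup>2 * (Im z)\<^sup>2 \<le> b\<^sup>2 * (pi / 2)\<^sup>2" by (intro mult_left_mono) auto
        then have "b\<^sup>2 * (Im z)\<^sup>2 \<le> b\<^sup>2 * pi\<^sup>2 / 4" by (simp add: power_divide)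
        moreover have "Re (- (of_real b * (z - of_real t))\<^sup>2) = b\<^sup>2 * (Im z)\<^sup>2 - (b * (Re z - t))\<^sup>2"
          by (simp add: power2_eq_square algebra_simps)
        ultimately show ?thesis by (simp add: norm_exp_eq_Re flip: exp_add)
      qed
      have "norm (h' z) \<le> integral {0..S} (\<lambda>t. D / (2 * l) * (b * exp (- (b * (Re z - t))\<^sup>2)))"
        unfolding h'_def cbox_interval
      proof (rule integral_norm_bound_integral)
        show "(\<lambda>t. of_real (v t / (2 * l) * b) * exp (- (of_real b * (z - of_real t))\<^sup>2) :: complex) integrable_on {0..S}"
          using l by (intro integrable_continuous_real continuous_intros cv) auto
        show "(\<lambda>t. D / (2 * l) * (b * exp (- (b * (Re z - t))\<^sup>2))) integrable_on {0..S}"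
          by (intro integrable_continuous_real continuous_intros)
        fix t assume t: "t \<in> {0..S}"
        have "norm (of_real (v t / (2 * l) * b) * exp (- (of_real b * (z - of_real t))\<^sup>2) :: complex)
          = \<bar>v t\<bar> / (2 * l) * b * norm (exp (- (of_real b * (z - of_real t))\<^sup>2))"
          using l b by (simp add: norm_mult norm_divide)
        also have "\<dots> \<le> C / (2 * l) * b * (exp (b\<^sup>2 * pi\<^sup>2 / 4) * exp (- (b * (Re z - t))\<^sup>2))"
          using l b vC[OF t] assms kern[of t]
          by (intro mult_mono divide_right_mono) auto
        finally show "norm (of_real (v t / (2 * l) * b) * exp (- (of_real b * (z - of_real t))\<^sup>2) :: complex)
           \<le> D / (2 * l) * (b * exp (- (b * (Re z - t))\<^sup>2))"
          by (simp add: D_def mult_ac)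
      qed
      also have "\<dots> = D / (2 * l) * integral {0..S} (\<lambda>t. b * exp (- (b * (Re z - t))\<^sup>2))"
        by (rule integral_mult_right)
      \<comment> \<open>The Gaussian has total mass at most \<open>2 * l\<close> whatever
        \<open>S\<close> is, which cancels the normalising factor
        \<open>1 / (2 * l)\<close>.\<close>
      also have "integral {0..S} (\<lambda>t. b * exp (- (b * (Re z - t))\<^sup>2)) = - e (b * (Re z - S)) - (- e (b * (Re z - 0)))"
        using S by (intro integral_unique fundamental_theorem_of_calculus)
          (auto intro!: derivative_eq_intros de' simp flip: has_real_derivative_iff_has_vector_derivative)
      also have "\<dots> \<le> 2 * l"
        using le[of "b * Re z"] le[of "- (b * (Re z - S))"] odd[of "b * (Re z - S)"] by simp
      then have "D / (2 * l) * (- e (b * (Re z - S)) - (- e (b * (Re z - 0)))) \<le> D / (2 * l) * (2 * l)"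
        using D l by (intro mult_left_mono) auto
      finally show ?thesis using l by simp
    qed
    \<comment> \<open>As \<open>h\<close> is real on the real axis, the imaginary part at z is that
      of an increment along a vertical segment of length at most pi/2.\<close>
    have imb: "\<bar>Im (h z)\<bar> \<le> D * (pi / 2)" if z: "\<bar>Im z\<bar> \<le> pi / 2" for z
    proof -
      have "norm (h z - h (of_real (Re z))) \<le> D * norm (z - of_real (Re z))"
      proof (rule field_differentiable_bound)
        show "convex {w::complex. \<bar>Im w\<bar> \<le> pi / 2}"
        proof -
          have "{w::complex. \<bar>Im w\<bar> \<le> pi / 2} = {w. Im w \<le> pi/2} \<inter> {w. Im w \<ge> - (pi/2)}" by auto
          then show ?thesis using convex_halfspace_Im_le convex_halfspace_Im_ge by (metis convex_Int)
        qed
        show "(h has_field_derivative h' w) (at w within {w. \<bar>Im w\<bar> \<le> pi / 2})" for w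
          using dh by (rule DERIV_subset) auto
      qed (use h'b z in auto)
      also have "norm (z - of_real (Re z)) = \<bar>Im z\<bar>"
        by (simp add: cmod_def)
      also have "D * \<bar>Im z\<bar> \<le> D * (pi / 2)" using z D by (intro mult_left_mono)
      finally have "norm (h z - h (of_real (Re z))) \<le> D * (pi / 2)" .
      moreover have "Im (h z - h (of_real (Re z))) = Im (h z)" by (simp add: hreal)
      ultimately show ?thesis using abs_Im_le_cmod[of "h z - h (of_real (Re z))"] by simp
    qed
    show "\<exists>h c. h holomorphic_on UNIV
       \<and> (\<forall>s\<in>{0..S}. Im (h (of_real s)) = 0 \<and> \<bar>Re (h (of_real s)) - c - integral {0..s} v\<bar> \<le> \<epsilon>)
       \<and> (\<forall>z. \<bar>Im z\<bar> \<le> pi / 2 \<longrightarrow> \<bar>Im (h z)\<bar> \<le> D * (pi / 2))"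
      using hh err imb hreal by (intro exI[of _ h] exI[of _ c]) auto
  qed
qed

subsection \<open>Bloch functions along a radius\<close>

text \<open>The Cayley map sends the disc into the right half-plane, because (1 + z) times the
  conjugate of 1 - z has real part 1 - |z|^2. The principal logarithm of its values therefore lies
  in the strip of half-width pi/2.\<close>

lemma norm_less_1_imp_Re_Cayley_pos:
  assumes "norm z < 1"
  shows "Re ((1 + z) / (1 - z)) > 0" "1 - z \<noteq> 0"
proof -
  show nz: "1 - z \<noteq> 0" using assms by auto
  have "(1 + z) / (1 - z) = (1 + z) * cnj (1 - z) / of_real ((norm (1 - z))\<^sup>2)"
    by (rule complex_div_cnj[unfolded of_real_power[symmetric]])
  moreover have "Re ((1 + z) * cnj (1 - z)) = 1 - (norm z)\<^sup>2"
    unfolding cmod_power2 by (simp add: power2_eq_square algebra_simps)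
  ultimately have "Re ((1 + z) / (1 - z)) = (1 - (norm z)\<^sup>2) / (norm (1 - z))\<^sup>2"
    by (metis Re_divide_of_real)
  moreover have "(norm z)\<^sup>2 < 1" using assms by (simp add: power_less_one_iff abs_square_less_1)
  ultimately show "Re ((1 + z) / (1 - z)) > 0" using nz by simp
qed

text \<open>The Bloch bound makes Im L Lipschitz in the hyperbolic coordinate, so the strip lemma
  with error 1 gives an approximate phase; multiplying by the opposite phase leaves an argument of
  size at most 1. One \<open>M\<close> serves all directions and all \<open>t\<close>, as the
  supremum in \<open>Phi\<close> and the limit towards the boundary require.\<close>

lemma bloch_bounded_conjugate_phase:
  assumes "L \<in> bloch"
  obtains M where "\<And>\<theta> t. \<lbrakk>0 \<le> t; t < 1\<rbrakk> \<Longrightarrow> \<exists>f. f holomorphic_on unit_disc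
     \<and> (\<forall>z\<in>unit_disc. cmod (f z) \<le> M)
     \<and> (\<forall>r\<in>{0..t}. cmod (exp (L (of_real r * cis \<theta>))) / 2 \<le> Re (f (of_real r * cis \<theta>) * exp (L (of_real r * cis \<theta>))))"
proof -
  obtain C0 where L: "L holomorphic_on unit_disc"
    and C0: "\<And>z. z \<in> unit_disc \<Longrightarrow> (1 - (norm z)\<^sup>2) * cmod (deriv L z) \<le> C0"
    using assms unfolding bloch_def by blast
  have dL: "(L has_field_derivative deriv L z) (at z)" if "z \<in> unit_disc" for z
    using holomorphic_derivI[OF L _ that] by simp
  have cdL: "continuous_on unit_disc (deriv L)"
    using holomorphic_on_imp_continuous_on[OF holomorphic_deriv[OF L]] by simp
  \<comment> \<open>The hyperbolic parametrisation of a radius moves with speed (1 - |p|^2) / 2, so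
    the Bloch constant is halved.\<close>
  define C where "C = C0 / 2"
  have "0 \<le> C0" using C0[of 0] by (simp add: order_trans[OF norm_ge_zero])
  then have C: "0 \<le> C" by (simp add: C_def)
  obtain M where M: "\<And>S v. \<lbrakk>0 \<le> S; continuous_on {0..S} v; \<forall>t\<in>{0..S}. \<bar>v t\<bar> \<le> C\<rbrakk> \<Longrightarrow>
     \<exists>h c. h holomorphic_on UNIV
       \<and> (\<forall>s\<in>{0..S}. Im (h (of_real s)) = 0 \<and> \<bar>Re (h (of_real s)) - c - integral {0..s} v\<bar> \<le> 1)
       \<and> (\<forall>z. \<bar>Im z\<bar> \<le> pi / 2 \<longrightarrow> \<bar>Im (h z)\<bar> \<le> M)"
    using lipschitz_approx_strip[OF C zero_less_one] by metis
  show ?thesis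
  proof (rule that[of "exp M"])
    fix \<theta> t :: real assume t: "0 \<le> t" "t < 1"
    \<comment> \<open>\<open>p\<close> inverts s = log((1 + r) / (1 - r)) = 2 artanh r along the
      ray; \<open>v\<close> below is the derivative of Im L along \<open>p\<close>.\<close>
    define p where "p = (\<lambda>s. complex_of_real (tanh (s / 2)) * cis \<theta>)"
    have np: "norm (p s) = \<bar>tanh (s / 2)\<bar>" for s by (simp add: p_def norm_mult)
    have p1: "p s \<in> unit_disc" for s
      using tanh_real_abs[of "s/2"] tanh_real_bounds[of "s/2"] by (simp add: np abs_less_iff)
    define v where "v = (\<lambda>s. Im (cis \<theta> * deriv L (p s)) * ((1 - (tanh (s / 2))\<^sup>2) / 2))"
    define S where "S = 2 * artanh t"
    have cp: "continuous_on A p" for A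
      unfolding p_def by (intro continuous_intros) auto
    have cv: "continuous_on {0..S} v"
      unfolding v_def
      by (intro continuous_intros continuous_on_compose2[OF cdL cp]) (use p1 in auto)
    have vC: "\<bar>v s\<bar> \<le> C" for s
    proof -
      have "\<bar>v s\<bar> = \<bar>Im (cis \<theta> * deriv L (p s))\<bar> * ((1 - (norm (p s))\<^sup>2) / 2)"
        using p1[of s] by (simp add: v_def abs_mult np abs_square_le_1 abs_of_nonneg)
      also have "\<dots> \<le> cmod (cis \<theta> * deriv L (p s)) * ((1 - (norm (p s))\<^sup>2) / 2)"
        using p1[of s] by (intro mult_right_mono abs_Im_le_cmod) (simp add: abs_square_le_1 np)
      also have "\<dots> \<le> C" using C0[OF p1[of s]] by (simp add: C_def norm_mult mult_ac)
      finally show ?thesis .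
    qed
    have vint: "integral {0..s} v = Im (L (p s)) - Im (L (p 0))" if "0 \<le> s" for s
    proof (rule integral_unique, rule fundamental_theorem_of_calculus[OF that])
      fix x :: real
      have "((\<lambda>s. tanh (s / 2)) has_real_derivative (1 - (tanh (x / 2))\<^sup>2) / 2) (at x)"
        by (auto intro!: derivative_eq_intros)
      then have "((\<lambda>s. complex_of_real (tanh (s / 2))) has_vector_derivative of_real ((1 - (tanh (x / 2))\<^sup>2) / 2)) (at x)"
        using has_vector_derivative_of_real has_real_derivative_iff_has_vector_derivative by blast
      then have "(p has_vector_derivative of_real ((1 - (tanh (x / 2))\<^sup>2) / 2) * cis \<theta>) (at x)"
        unfolding p_def by (rule has_vector_derivative_mult_left)
      from field_vector_diff_chain_at[OF this dL[OF p1]]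
      have "((\<lambda>s. L (p s)) has_vector_derivative of_real ((1 - (tanh (x / 2))\<^sup>2) / 2) * cis \<theta> * deriv L (p x)) (at x)"
        by (simp add: o_def)
      from bounded_linear.has_vector_derivative[OF bounded_linear_Im this]
      moreover have "Im (of_real ((1 - (tanh (x / 2))\<^sup>2) / 2) * cis \<theta> * deriv L (p x)) = v x"
        by (simp add: v_def field_simps)
      ultimately have "((\<lambda>s. Im (L (p s))) has_vector_derivative v x) (at x)" by simp
      then show "((\<lambda>s. Im (L (p s))) has_vector_derivative v x) (at x within {0..s})"
        by (rule has_vector_derivative_at_within)
    qed
    have S0: "S \<ge> 0" using t by (simp add: S_def artanh_def)
    obtain h c where h: "h holomorphic_on UNIV"
       and hs: "\<And>s. s \<in> {0..S} \<Longrightarrow> Im (h (of_real s)) = 0 \<and> \<bar>Re (h (of_real s)) - c - integral {0..s} v\<bar> \<le> 1"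
       and hM: "\<And>z. \<bar>Im z\<bar> \<le> pi / 2 \<Longrightarrow> \<bar>Im (h z)\<bar> \<le> M"
      using M[OF S0 cv] vC by blast
    \<comment> \<open>The holomorphic extension to the disc of the hyperbolic coordinate on the ray
      of angle \<open>\<theta>\<close>: it satisfies q (p s) = s for the parameters s used here and
      maps the disc into the strip.\<close>
    define q where "q = (\<lambda>z. Ln ((1 + z * cis (- \<theta>)) / (1 - z * cis (- \<theta>))))"
    \<comment> \<open>On the ray \<open>h\<close> is about c + Im L(p s) - Im L(p 0), so the real
      constant removed here leaves approximately Im L. The modulus of \<open>f\<close> is exp(Im h),
      which is where the bound on the strip enters.\<close>
    define f where "f = (\<lambda>z. exp (- \<i> * (h (q z) - of_real (c - Im (L (p 0))))))"
    have rot: "norm (z * cis (- \<theta>)) < 1" if "z \<in> unit_disc" for z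
      using that by (simp add: norm_mult)
    have q: "q holomorphic_on unit_disc"
      unfolding q_def
    proof (intro holomorphic_intros)
      fix z :: complex assume z: "z \<in> unit_disc"
      show "1 - z * cis (- \<theta>) \<noteq> 0" using norm_less_1_imp_Re_Cayley_pos(2)[OF rot[OF z]] .
      show "(1 + z * cis (- \<theta>)) / (1 - z * cis (- \<theta>)) \<notin> \<real>\<^sub>\<le>\<^sub>0"
        using norm_less_1_imp_Re_Cayley_pos(1)[OF rot[OF z]] by (auto simp: complex_nonpos_Reals_iff)
    qed
    have "f holomorphic_on unit_disc"
      unfolding f_def
      by (intro holomorphic_intros holomorphic_on_compose_gen[OF q h, unfolded o_def]) auto
    moreover have "cmod (f z) \<le> exp M" if z: "z \<in> unit_disc" for z
    proof -
      have "\<bar>Im (q z)\<bar> \<le> pi / 2"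
        using Re_Ln_pos_lt_imp[OF norm_less_1_imp_Re_Cayley_pos(1)[OF rot[OF z]]] by (simp add: q_def)
      from hM[OF this] show ?thesis by (simp add: f_def norm_exp_eq_Re)
    qed
    moreover have "cmod (exp (L (of_real r * cis \<theta>))) / 2
        \<le> Re (f (of_real r * cis \<theta>) * exp (L (of_real r * cis \<theta>)))" if r: "r \<in> {0..t}" for r
    proof -
      define s where "s = 2 * artanh r"
      have "artanh r \<le> artanh t"
        using r t by (auto simp: artanh_def intro!: ln_mono divide_mono frac_le)
      moreover have "0 \<le> artanh r" using r t by (simp add: artanh_def)
      ultimately have s: "s \<in> {0..S}" by (simp add: s_def S_def)
      have "tanh (s / 2) = r"
      proof -
        have "0 < (1 + r) / (1 - r)" using r t by simp
        then have "s / 2 = ln (sqrt ((1 + r) / (1 - r)))" by (simp add: s_def artanh_def ln_sqrt)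
        also have "tanh \<dots> = ((1 + r) / (1 - r) - 1) / ((1 + r) / (1 - r) + 1)"
          using \<open>0 < (1 + r) / (1 - r)\<close> by (subst tanh_ln_real) auto
        also have "\<dots> = r" using r t by (simp add: divide_simps)
        finally show ?thesis .
      qed
      then have ps: "p s = of_real r * cis \<theta>" by (simp add: p_def)
      have "of_real r * cis \<theta> * cis (- \<theta>) = complex_of_real r" by (simp add: mult.assoc cis_mult)
      then have "q (of_real r * cis \<theta>) = Ln (of_real ((1 + r) / (1 - r)))"
        unfolding q_def by (simp only:) simp
      also have "\<dots> = of_real (ln ((1 + r) / (1 - r)))" using r t by (subst Ln_of_real) auto
      also have "\<dots> = of_real s" by (simp add: s_def artanh_def)
      finally have qs: "q (of_real r * cis \<theta>) = of_real s" .
      define x where "x = Re (h (of_real s)) - c + Im (L (p 0))"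
      define y where "y = L (of_real r * cis \<theta>)"
      have "h (of_real s) = of_real (Re (h (of_real s)))" using hs[OF s] by (simp add: complex_eq_iff)
      then have "f (of_real r * cis \<theta>) = exp (- \<i> * of_real x)"
        unfolding f_def qs x_def by (metis (no_types, opaque_lifting) diff_diff_eq2 diff_add_eq of_real_diff of_real_add)
      then have "f (of_real r * cis \<theta>) * exp y = exp (y - \<i> * of_real x)"
        by (simp add: exp_diff exp_minus field_simps)
      then have "Re (f (of_real r * cis \<theta>) * exp y) = exp (Re y) * cos (Im y - x)"
        by (simp add: Re_exp)
      moreover have "\<bar>Im y - x\<bar> \<le> 1"
      proof -
        have "Im y - x = - (Re (h (of_real s)) - c - integral {0..s} v)"
          using vint[of s] s by (simp add: x_def y_def ps)
        then show ?thesis using hs[OF s] by (simp only: abs_minus_cancel)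
      qed
      \<comment> \<open>The error 1 is below pi/3, so at least half of the modulus survives in the
        real part.\<close>
      have "1 / 2 \<le> cos (Im y - x)"
      proof -
        have "cos (pi / 3) \<le> cos \<bar>Im y - x\<bar>"
          using \<open>\<bar>Im y - x\<bar> \<le> 1\<close> pi_gt3 by (intro cos_monotone_0_pi_le) auto
        then show ?thesis by (simp add: cos_60)
      qed
      then have "exp (Re y) * (1 / 2) \<le> exp (Re y) * cos (Im y - x)"
        by (intro mult_left_mono) auto
      ultimately show ?thesis by (simp add: y_def norm_exp_eq_Re)
    qed
    ultimately show "\<exists>f. f holomorphic_on unit_disc
     \<and> (\<forall>z\<in>unit_disc. cmod (f z) \<le> exp M)
     \<and> (\<forall>r\<in>{0..t}. cmod (exp (L (of_real r * cis \<theta>))) / 2 \<le> Re (f (of_real r * cis \<theta>) * exp (L (of_real r * cis \<theta>))))"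
      by blast
  qed
qed

subsection \<open>The operator and the weighted spaces\<close>

lemma cis_disc: "0 \<le> r \<Longrightarrow> r < 1 \<Longrightarrow> of_real r * cis \<theta> \<in> unit_disc"
  by (simp add: norm_mult)

lemma polar_2pi:
  obtains \<theta> where "0 \<le> \<theta>" "\<theta> < 2 * pi" "z = of_real (norm z) * cis \<theta>"
  using that[of "Arg2pi z"] Arg2pi[of z] unfolding is_Arg_def cis_conv_exp by blast

lemma weightD:
  assumes "weight \<mu>"
  shows "continuous_on unit_disc \<mu>"
    and "\<And>z. z \<in> unit_disc \<Longrightarrow> 0 \<le> \<mu> z"
    and "\<And>z w. \<lbrakk>w \<in> unit_disc; norm z \<le> norm w\<rbrakk> \<Longrightarrow> \<mu> w \<le> \<mu> z"
proof -
  show "continuous_on unit_disc \<mu>" and "\<And>z. z \<in> unit_disc \<Longrightarrow> 0 \<le> \<mu> z"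
    using assms unfolding weight_def by blast+
  fix z w :: complex assume w: "w \<in> unit_disc" and "norm z \<le> norm w"
  then have "z \<in> unit_disc" by simp
  with w \<open>norm z \<le> norm w\<close> show "\<mu> w \<le> \<mu> z" using assms unfolding weight_def by blast
qed

lemma weight_polar:
  assumes "weight \<mu>" "0 \<le> r" "r < 1"
  shows "\<mu> (of_real r * cis \<theta>) = \<mu> (of_real r)" "0 \<le> \<mu> (of_real r)" "\<mu> (of_real r) \<le> \<mu> 0"
proof -
  have "\<mu> (of_real r * cis \<theta>) = \<mu> (complex_of_real (norm (of_real r * cis \<theta>)))"
    using assms cis_disc unfolding weight_def by blast
  then show "\<mu> (of_real r * cis \<theta>) = \<mu> (of_real r)" using assms by (simp add: norm_mult)
  show "0 \<le> \<mu> (of_real r)" "\<mu> (of_real r) \<le> \<mu> 0"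
    using assms weightD(2)[OF assms(1), of "of_real r"] weightD(3)[OF assms(1), of "of_real r" 0] by auto
qed

lemma continuous_on_ray:
  assumes "continuous_on unit_disc f" "0 \<le> s" "t < 1"
  shows "continuous_on {s..t} (\<lambda>r. f (of_real r * cis \<theta>))"
  by (rule continuous_on_compose2[OF assms(1)]) (use assms in \<open>auto intro!: continuous_intros simp: norm_mult\<close>)

lemma bounded_on_smaller_disc:
  fixes f :: "complex \<Rightarrow> complex"
  assumes "continuous_on unit_disc f" "t < 1"
  obtains K where "0 \<le> K" "\<And>z. norm z \<le> t \<Longrightarrow> norm (f z) \<le> K"
proof -
  have "compact (f ` cball 0 t)"
    by (rule compact_continuous_image[OF continuous_on_subset[OF assms(1)]]) (use assms in auto)
  then obtain K where "K > 0" "\<And>x. x \<in> f ` cball 0 t \<Longrightarrow> norm x \<le> K"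
    using compact_imp_bounded bounded_pos by metis
  then show ?thesis by (intro that[of K]) (auto simp: less_imp_le)
qed

section \<open>The integral operator as a primitive and along rays\<close>

lemma Tg_has_derivative:
  assumes g: "g holomorphic_on unit_disc" and f: "f holomorphic_on unit_disc" and z: "z \<in> unit_disc"
  shows "(Tg g f has_field_derivative f z * deriv g z) (at z)"
proof -
  have "(\<lambda>w. f w * deriv g w) holomorphic_on unit_disc"
    by (intro holomorphic_intros f holomorphic_deriv[OF g]) auto
  then obtain P where P: "\<And>w. w \<in> unit_disc \<Longrightarrow> (P has_field_derivative f w * deriv g w) (at w within unit_disc)"
    using holomorphic_convex_primitive'[of unit_disc "\<lambda>w. f w * deriv g w"] by auto
  \<comment> \<open>\<open>Tg\<close> integrates along the segment from 0; convexity keeps that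
    segment in the disc, so any primitive computes it.\<close>
  have eq: "Tg g f w = P w - P 0" if "w \<in> unit_disc" for w
  proof -
    have "path_image (linepath 0 w) \<subseteq> unit_disc"
      using that by (simp add: closed_segment_subset)
    from contour_integral_primitive[OF P valid_path_linepath this]
    show ?thesis unfolding Tg_def by (simp add: contour_integral_unique)
  qed
  have "(P has_field_derivative f z * deriv g z) (at z)"
    using P[OF z] by (simp only: at_within_open[OF z open_ball])
  from DERIV_diff[OF this DERIV_const[of "P 0"]]
  have "((\<lambda>w. P w - P 0) has_field_derivative f z * deriv g z) (at z)" by simp
  then show ?thesis
    by (rule has_field_derivative_transform_within_open[of _ _ _ unit_disc]) (use z eq in auto)
qed

lemma Tg_holomorphic:
  assumes "g holomorphic_on unit_disc" "f holomorphic_on unit_disc"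
  shows "Tg g f holomorphic_on unit_disc"
  using Tg_has_derivative[OF assms] by (meson holomorphic_on_open open_ball)

lemma Tg_0 [simp]: "Tg g f 0 = 0"
  by (simp add: Tg_def)

lemma Tg_ray_has_integral:
  assumes g: "g holomorphic_on unit_disc" and f: "f holomorphic_on unit_disc"
    and st: "0 \<le> s" "s \<le> t" "t < 1"
  shows "((\<lambda>r. f (of_real r * cis \<theta>) * deriv g (of_real r * cis \<theta>) * cis \<theta>) has_integral
    (Tg g f (of_real t * cis \<theta>) - Tg g f (of_real s * cis \<theta>))) {s..t}"
proof (rule fundamental_theorem_of_calculus[OF st(2)])
  fix r assume r: "r \<in> {s..t}"
  have "((\<lambda>r. of_real r * cis \<theta>) has_vector_derivative cis \<theta>) (at r)"
    by (rule has_vector_derivative_real_field[where f = "\<lambda>z. z * cis \<theta>"]) (auto intro!: derivative_eq_intros)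
  from field_vector_diff_chain_at[OF this Tg_has_derivative[OF g f cis_disc]] r st
  have "((\<lambda>r. Tg g f (of_real r * cis \<theta>)) has_vector_derivative
      cis \<theta> * (f (of_real r * cis \<theta>) * deriv g (of_real r * cis \<theta>))) (at r)"
    by (simp add: o_def)
  then show "((\<lambda>r. Tg g f (of_real r * cis \<theta>)) has_vector_derivative
      f (of_real r * cis \<theta>) * deriv g (of_real r * cis \<theta>) * cis \<theta>) (at r within {s..t})"
    by (simp add: mult.commute has_vector_derivative_at_within)
qed

lemma norm_Tg_increment_le:
  assumes g: "g holomorphic_on unit_disc" and f: "f holomorphic_on unit_disc"
    and st: "0 \<le> s" "s \<le> t" "t < 1"
    and w: "continuous_on {s..t} w" "\<And>r. r \<in> {s..t} \<Longrightarrow> norm (f (of_real r * cis \<theta>) * deriv g (of_real r * cis \<theta>)) \<le> w r"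
  shows "norm (Tg g f (of_real t * cis \<theta>) - Tg g f (of_real s * cis \<theta>)) \<le> integral {s..t} w"
proof -
  note I = Tg_ray_has_integral[OF g f st, of \<theta>]
  have "norm (integral {s..t} (\<lambda>r. f (of_real r * cis \<theta>) * deriv g (of_real r * cis \<theta>) * cis \<theta>)) \<le> integral {s..t} w"
    using w by (intro integral_norm_bound_integral has_integral_integrable[OF I] integrable_continuous_real)
      (auto simp: norm_mult)
  then show ?thesis using integral_unique[OF I] by simp
qed

text \<open>The segment from 0 to z is shorter than 1, which absorbs the length factor. This crude
  estimate handles compact subdiscs in both directions of the theorem.\<close>

lemma norm_Tg_le:
  assumes g: "g holomorphic_on unit_disc" and f: "f holomorphic_on unit_disc" and t: "t < 1"
    and a: "\<And>z. norm z \<le> t \<Longrightarrow> norm (f z) \<le> a"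
    and k: "\<And>z. norm z \<le> t \<Longrightarrow> norm (deriv g z) \<le> k"
    and z: "norm z \<le> t"
  shows "norm (Tg g f z) \<le> a * k"
proof -
  have zd: "z \<in> unit_disc" using z t by simp
  obtain \<theta> where \<theta>: "z = of_real (norm z) * cis \<theta>" by (rule polar_2pi)
  have nn: "0 \<le> a" "0 \<le> k" using order_trans[OF norm_ge_zero a[OF z]] order_trans[OF norm_ge_zero k[OF z]] .
  have "norm (Tg g f (of_real (norm z) * cis \<theta>) - Tg g f (of_real 0 * cis \<theta>)) \<le> integral {0..norm z} (\<lambda>_. a * k)"
    using zd z nn by (intro norm_Tg_increment_le[OF g f]) (auto simp: norm_mult intro!: mult_mono a k)
  also have "\<dots> = norm z * (a * k)" by simp
  also have "\<dots> \<le> 1 * (a * k)" using zd nn by (intro mult_right_mono) auto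
  finally show ?thesis using \<theta> by simp
qed

section \<open>Weighted sup-norm estimates\<close>

lemma Hinf_norm_upper:
  "f \<in> Hinf \<nu> \<Longrightarrow> z \<in> unit_disc \<Longrightarrow> \<nu> z * cmod (f z) \<le> Hinf_norm \<nu> f"
  unfolding Hinf_def Hinf_norm_def by (auto intro: cSUP_upper)

lemma Hinf_norm_least:
  "(\<And>z. z \<in> unit_disc \<Longrightarrow> \<nu> z * cmod (f z) \<le> B) \<Longrightarrow> Hinf_norm \<nu> f \<le> B"
  unfolding Hinf_norm_def by (rule cSUP_least) auto

lemma Hinf_intro:
  "f holomorphic_on unit_disc \<Longrightarrow> (\<And>z. z \<in> unit_disc \<Longrightarrow> \<nu> z * cmod (f z) \<le> B) \<Longrightarrow> f \<in> Hinf \<nu>"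
  unfolding Hinf_def by (auto intro!: bdd_aboveI2)

text \<open>Ensures that the supremum defining \<open>Hinf_norm\<close> of a difference is over a
  bounded set, so that it dominates the pointwise values.\<close>

lemma Hinf_diff:
  assumes "weight \<mu>" "f \<in> Hinf \<mu>" "h \<in> Hinf \<mu>"
  shows "(\<lambda>z. f z - h z) \<in> Hinf \<mu>"
proof (rule Hinf_intro)
  show "(\<lambda>z. f z - h z) holomorphic_on unit_disc"
    using assms by (auto simp: Hinf_def intro!: holomorphic_intros)
  fix z assume z: "z \<in> unit_disc"
  have "\<mu> z * cmod (f z - h z) \<le> \<mu> z * (cmod (f z) + cmod (h z))"
    by (intro mult_left_mono norm_triangle_ineq4 weightD(2) assms z)
  also have "\<dots> \<le> Hinf_norm \<mu> f + Hinf_norm \<mu> h"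
    using Hinf_norm_upper[OF assms(2) z] Hinf_norm_upper[OF assms(3) z] by (simp add: distrib_left)
  finally show "\<mu> z * cmod (f z - h z) \<le> Hinf_norm \<mu> f + Hinf_norm \<mu> h" .
qed

section \<open>The radial integrals and their supremum over directions\<close>

lemma Phi_integrand_continuous:
  assumes "g holomorphic_on unit_disc" "weight \<nu>" "\<And>z. z \<in> unit_disc \<Longrightarrow> 0 < \<nu> z" "0 \<le> s" "t < 1"
  shows "continuous_on {s..t} (\<lambda>r. cmod (deriv g (of_real r * cis \<theta>)) / \<nu> (of_real r))"
proof -
  have 1: "continuous_on unit_disc (deriv g)"
    using assms(1) by (intro holomorphic_on_imp_continuous_on holomorphic_deriv) auto
  have 2: "continuous_on {s..t} (\<lambda>r. \<nu> (complex_of_real r))"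
    using continuous_on_ray[OF weightD(1)[OF assms(2)] assms(4,5), of 0] by simp
  have "\<nu> (complex_of_real r) \<noteq> 0" if "r \<in> {s..t}" for r
    using assms(3)[of "of_real r"] that assms(4,5) by force
  then show ?thesis using assms by (intro continuous_intros continuous_on_ray[OF 1] 2) auto
qed

text \<open>The supremum in \<^const>\<open>Phi\<close> is taken over a bounded set, hence is not a junk value.\<close>

lemma Phi_bdd_above:
  assumes g: "g holomorphic_on unit_disc" and \<nu>: "weight \<nu>" "\<And>z. z \<in> unit_disc \<Longrightarrow> 0 < \<nu> z"
    and \<mu>: "weight \<mu>" and st: "0 \<le> t2" "t2 \<le> t1" "t1 < 1"
  shows "bdd_above ((\<lambda>\<theta>. \<mu> (of_real t1) *
    integral {t2..t1} (\<lambda>r. cmod (deriv g (of_real r * cis \<theta>)) / \<nu> (of_real r))) ` {0..<2*pi})"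
proof -
  have "continuous_on unit_disc (deriv g)"
    using g by (intro holomorphic_on_imp_continuous_on holomorphic_deriv) auto
  then obtain K where K: "0 \<le> K" "\<And>z. norm z \<le> t1 \<Longrightarrow> norm (deriv g z) \<le> K"
    using bounded_on_smaller_disc st by metis
  \<comment> \<open>As \<open>\<nu>\<close> decreases, its value at \<open>t1\<close> is the
    smallest one on {t2..t1}, so a constant majorises the integrand for all directions at
    once.\<close>
  have "\<mu> (of_real t1) * integral {t2..t1} (\<lambda>r. cmod (deriv g (of_real r * cis \<theta>)) / \<nu> (of_real r))
      \<le> \<mu> (of_real t1) * integral {t2..t1} (\<lambda>r. K / \<nu> (of_real t1))" for \<theta>
  proof (intro mult_left_mono integral_le integrable_continuous_real)
    show "continuous_on {t2..t1} (\<lambda>r. cmod (deriv g (of_real r * cis \<theta>)) / \<nu> (of_real r))"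
      by (rule Phi_integrand_continuous) (use assms in auto)
    fix r assume r: "r \<in> {t2..t1}"
    show "cmod (deriv g (of_real r * cis \<theta>)) / \<nu> (of_real r) \<le> K / \<nu> (of_real t1)"
    proof (rule frac_le)
      show "\<nu> (complex_of_real t1) \<le> \<nu> (of_real r)" using r st by (intro weightD(3)[OF \<nu>(1)]) auto
      show "0 < \<nu> (complex_of_real t1)" using \<nu>(2)[of "of_real t1"] st by auto
    qed (use K r st in \<open>auto simp: norm_mult\<close>)
  qed (use weight_polar(2)[OF \<mu>, of t1] st in \<open>auto intro!: continuous_intros\<close>)
  then show ?thesis by (intro bdd_aboveI2)
qed

lemma Phi_upper:
  assumes g: "g holomorphic_on unit_disc" and \<nu>: "weight \<nu>" "\<And>z. z \<in> unit_disc \<Longrightarrow> 0 < \<nu> z"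
    and \<mu>: "weight \<mu>" and st: "0 \<le> t2" "t2 \<le> t1" "t1 < 1" and "\<theta> \<in> {0..<2*pi}"
  shows "\<mu> (of_real t1) * integral {t2..t1} (\<lambda>r. cmod (deriv g (of_real r * cis \<theta>)) / \<nu> (of_real r)) \<le> Phi g \<nu> \<mu> t1 t2"
  unfolding Phi_def by (rule cSUP_upper[OF _ Phi_bdd_above]) (use assms in auto)

lemma Phi_nonneg:
  assumes g: "g holomorphic_on unit_disc" and \<nu>: "weight \<nu>" "\<And>z. z \<in> unit_disc \<Longrightarrow> 0 < \<nu> z"
    and \<mu>: "weight \<mu>" and st: "0 \<le> t2" "t2 \<le> t1" "t1 < 1"
  shows "0 \<le> Phi g \<nu> \<mu> t1 t2"
proof -
  have "0 \<le> \<mu> (of_real t1) * integral {t2..t1} (\<lambda>r. cmod (deriv g (of_real r * cis 0)) / \<nu> (of_real r))"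
  proof (intro mult_nonneg_nonneg integral_nonneg integrable_continuous_real Phi_integrand_continuous[OF g \<nu>])
    show "0 \<le> cmod (deriv g (of_real r * cis 0)) / \<nu> (of_real r)" if "r \<in> {t2..t1}" for r
      using \<nu>(2)[of "of_real r"] that st by (auto intro!: divide_nonneg_pos)
  qed (use weight_polar(2)[OF \<mu>] st in auto)
  also have "\<dots> \<le> Phi g \<nu> \<mu> t1 t2" by (rule Phi_upper) (use assms in auto)
  finally show ?thesis .
qed

subsection \<open>Sufficiency\<close>

lemma Tg_diff:
  assumes "g holomorphic_on unit_disc" "f holomorphic_on unit_disc" "h holomorphic_on unit_disc" "z \<in> unit_disc"
  shows "Tg g (\<lambda>w. f w - h w) z = Tg g f z - Tg g h z"
proof -
  have sub: "closed_segment 0 z \<subseteq> unit_disc" using assms(4) by (simp add: closed_segment_subset)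
  have "(\<lambda>w. k w * deriv g w) contour_integrable_on linepath 0 z" if "k holomorphic_on unit_disc" for k
  proof (rule contour_integrable_continuous_linepath[OF continuous_on_subset[OF _ sub]])
    show "continuous_on unit_disc (\<lambda>w. k w * deriv g w)"
      by (intro holomorphic_on_imp_continuous_on holomorphic_intros that holomorphic_deriv[OF assms(1)]) auto
  qed
  then show ?thesis unfolding Tg_def
    by (simp add: left_diff_distrib contour_integral_diff assms(2,3))
qed

text \<open>For |z| at most \<open>t\<close> the crude bound \<open>a * k\<close> suffices. Beyond
  \<open>t\<close>, the value at radius \<open>s\<close> is again at most \<open>a * k\<close>, and
  the increment from \<open>s\<close> to |z| is controlled by |f| \<le> B / \<nu> and
  \<open>Phi\<close>. Two radii occur because of the iterated limit: \<open>s\<close> is the lower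
  end of the integral, and \<open>t\<close> is where the bound on \<open>Phi\<close> sets
  in.\<close>

lemma Tg_weighted_bound:
  assumes g: "g holomorphic_on unit_disc" and \<nu>: "weight \<nu>" "\<And>z. z \<in> unit_disc \<Longrightarrow> 0 < \<nu> z"
    and \<mu>: "weight \<mu>" and f: "f holomorphic_on unit_disc"
    and B: "\<And>z. z \<in> unit_disc \<Longrightarrow> \<nu> z * cmod (f z) \<le> B"
    and st: "0 \<le> s" "s \<le> t" "t < 1"
    and a: "\<And>z. norm z \<le> t \<Longrightarrow> norm (f z) \<le> a"
    and k: "\<And>z. norm z \<le> t \<Longrightarrow> norm (deriv g z) \<le> k"
    and \<epsilon>: "\<And>r. t < r \<Longrightarrow> r < 1 \<Longrightarrow> Phi g \<nu> \<mu> r s \<le> \<epsilon>" "0 \<le> \<epsilon>"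
    and z: "z \<in> unit_disc"
  shows "\<mu> z * cmod (Tg g f z) \<le> \<mu> 0 * (a * k) + B * \<epsilon>"
proof -
  have \<mu>z: "0 \<le> \<mu> z" "\<mu> z \<le> \<mu> 0" using weightD(2)[OF \<mu> z] weightD(3)[OF \<mu> z, of 0] by auto
  have B0: "0 \<le> B" using order_trans[OF _ B[of 0]] \<nu>(2)[of 0] by simp
  have "norm (f 0) \<le> a" "norm (deriv g 0) \<le> k" using a[of 0] k[of 0] st by auto
  then have ak: "0 \<le> a * k" by (metis mult_nonneg_nonneg norm_ge_zero order_trans)
  have inner: "norm (Tg g f w) \<le> a * k" if "norm w \<le> t" for w
    by (rule norm_Tg_le[OF g f st(3) a k that])
  show ?thesis
  proof (cases "norm z \<le> t")
    case True
    then have "\<mu> z * cmod (Tg g f z) \<le> \<mu> 0 * (a * k)"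
      using \<mu>z by (intro mult_mono inner) auto
    then show ?thesis using B0 \<epsilon>(2) by (simp add: add_increasing2)
  next
    case False
    define r where "r = norm z"
    have r: "s \<le> r" "r < 1" "t < r" using False st z by (auto simp: r_def)
    obtain \<theta> where \<theta>: "0 \<le> \<theta>" "\<theta> < 2 * pi" and zr: "z = of_real r * cis \<theta>"
      unfolding r_def by (rule polar_2pi)
    have \<mu>r: "\<mu> z = \<mu> (of_real r)" unfolding zr using weight_polar(1)[OF \<mu>] r st by auto
    define w where "w = (\<lambda>x. cmod (deriv g (of_real x * cis \<theta>)) / \<nu> (of_real x))"
    have "norm (Tg g f (of_real r * cis \<theta>) - Tg g f (of_real s * cis \<theta>)) \<le> integral {s..r} (\<lambda>x. B * w x)"
    proof (rule norm_Tg_increment_le[OF g f st(1) r(1,2)])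
      show "continuous_on {s..r} (\<lambda>x. B * w x)"
        unfolding w_def by (intro continuous_intros Phi_integrand_continuous[OF g \<nu>] st r)
      fix x assume x: "x \<in> {s..r}"
      then have x1: "0 \<le> x" "x < 1" using st r by auto
      have "\<nu> (of_real x) * cmod (f (of_real x * cis \<theta>)) \<le> B"
        using B[OF cis_disc[OF x1]] weight_polar(1)[OF \<nu>(1) x1] by simp
      moreover have "0 < \<nu> (of_real x)" using \<nu>(2)[of "of_real x"] x1 by simp
      ultimately have "cmod (f (of_real x * cis \<theta>)) \<le> B / \<nu> (of_real x)" by (simp add: field_simps)
      then have "cmod (f (of_real x * cis \<theta>)) * cmod (deriv g (of_real x * cis \<theta>))
          \<le> B / \<nu> (of_real x) * cmod (deriv g (of_real x * cis \<theta>))" by (rule mult_right_mono) simp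
      then show "norm (f (of_real x * cis \<theta>) * deriv g (of_real x * cis \<theta>)) \<le> B * w x"
        by (simp add: norm_mult w_def)
    qed
    also have "\<dots> = B * integral {s..r} w" by (rule integral_mult_right)
    finally have "cmod (Tg g f z) \<le> cmod (Tg g f (of_real s * cis \<theta>)) + B * integral {s..r} w"
      unfolding zr by (smt (verit) norm_triangle_ineq2)
    also have "\<dots> \<le> a * k + B * integral {s..r} w"
      using st by (intro add_right_mono inner) (simp add: norm_mult)
    finally have "\<mu> z * cmod (Tg g f z) \<le> \<mu> z * (a * k + B * integral {s..r} w)"
      using \<mu>z by (intro mult_left_mono)
    also have "\<dots> = \<mu> z * (a * k) + B * (\<mu> (of_real r) * integral {s..r} w)"
      by (simp add: \<mu>r algebra_simps)
    also have "\<dots> \<le> \<mu> 0 * (a * k) + B * \<epsilon>"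
    proof (intro add_mono mult_right_mono mult_left_mono \<mu>z ak B0)
      show "\<mu> (of_real r) * integral {s..r} w \<le> \<epsilon>"
        unfolding w_def
        by (rule order_trans[OF Phi_upper[OF g \<nu> \<mu> st(1) r(1,2)] \<epsilon>(1)]) (use r \<theta> in auto)
    qed
    finally show ?thesis .
  qed
qed

lemma Tg_compact_if_Phi_tendsto_0:
  assumes g: "g holomorphic_on unit_disc" and \<nu>: "weight \<nu>" "\<And>z. z \<in> unit_disc \<Longrightarrow> 0 < \<nu> z"
    and \<mu>: "weight \<mu>"
    and lim: "((\<lambda>t2. Limsup (at_left 1) (\<lambda>t1. ereal (Phi g \<nu> \<mu> t1 t2))) \<longlongrightarrow> 0) (at_left (1::real))"
  shows "Tg_compact g \<nu> \<mu>"
proof -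
  \<comment> \<open>The outer limit supplies \<open>s\<close>, and then the inner
    \<open>Limsup\<close> supplies the threshold for the upper end; the maximum with
    \<open>s\<close> secures \<open>s \<le> t\<close>.\<close>
  have cutoff: "\<exists>s t. 0 \<le> s \<and> s \<le> t \<and> t < 1 \<and> (\<forall>r. t < r \<longrightarrow> r < 1 \<longrightarrow> Phi g \<nu> \<mu> r s \<le> \<epsilon>)"
    if "\<epsilon> > 0" for \<epsilon>
  proof -
    have "eventually (\<lambda>s. Limsup (at_left 1) (\<lambda>t. ereal (Phi g \<nu> \<mu> t s)) < ereal \<epsilon> \<and> s \<in> {0<..<1}) (at_left 1)"
      using order_tendstoD(2)[OF lim, of "ereal \<epsilon>"] eventually_at_left_real[of 0 1] that
      by (intro eventually_conj) (auto simp: zero_ereal_def)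
    then obtain s where s: "Limsup (at_left 1) (\<lambda>t. ereal (Phi g \<nu> \<mu> t s)) < ereal \<epsilon>" "0 < s" "s < 1"
      using eventually_happens'[OF trivial_limit_at_left_real] by fastforce
    from Limsup_lessD[OF s(1)] obtain b where b: "b < 1" "\<And>t. b < t \<Longrightarrow> t < 1 \<Longrightarrow> Phi g \<nu> \<mu> t s < \<epsilon>"
      by (auto simp: eventually_at_left[of 0])
    show ?thesis
      by (rule exI[of _ s], rule exI[of _ "max s b"]) (use s b in \<open>auto simp: less_imp_le\<close>)
  qed
  have cg: "continuous_on unit_disc (deriv g)"
    using g by (intro holomorphic_on_imp_continuous_on holomorphic_deriv) auto
  have bounded: "Tg g f \<in> Hinf \<mu>" if f: "f holomorphic_on unit_disc"
    and B: "\<And>z. z \<in> unit_disc \<Longrightarrow> \<nu> z * cmod (f z) \<le> B" for f B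
  proof -
    obtain s t where st: "0 \<le> s" "s \<le> t" "t < 1" "\<And>r. t < r \<Longrightarrow> r < 1 \<Longrightarrow> Phi g \<nu> \<mu> r s \<le> 1"
      using cutoff[of 1] by auto
    obtain k where k: "\<And>z. norm z \<le> t \<Longrightarrow> norm (deriv g z) \<le> k"
      using bounded_on_smaller_disc[OF cg st(3)] by metis
    obtain a where a: "\<And>z. norm z \<le> t \<Longrightarrow> norm (f z) \<le> a"
      using bounded_on_smaller_disc[OF holomorphic_on_imp_continuous_on[OF f] st(3)] by metis
    show ?thesis
      by (rule Hinf_intro[OF Tg_holomorphic[OF g f] Tg_weighted_bound[OF g \<nu> \<mu> f B st(1-3) a k st(4)]]) auto
  qed
  show ?thesis unfolding Tg_compact_def
  proof (intro conjI ballI allI impI)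
    fix f assume f: "f \<in> Hinf \<nu>"
    show "Tg g f \<in> Hinf \<mu>"
      by (rule bounded[OF _ Hinf_norm_upper[OF f]]) (use f in \<open>auto simp: Hinf_def\<close>)
  next
    fix fs :: "nat \<Rightarrow> complex \<Rightarrow> complex" and B
    assume "\<forall>n. fs n \<in> Hinf \<nu> \<and> Hinf_norm \<nu> (fs n) \<le> B"
    then have fsn: "\<And>n. fs n \<in> Hinf \<nu>" "\<And>n. Hinf_norm \<nu> (fs n) \<le> B" by auto
    have fsB: "\<nu> z * cmod (fs n z) \<le> B" if "z \<in> unit_disc" for n z
      using Hinf_norm_upper[OF fsn(1) that] fsn(2) by (rule order_trans)
    have fs: "fs n holomorphic_on unit_disc" for n using fsn(1) by (auto simp: Hinf_def)
    have B0: "0 \<le> B" using order_trans[OF _ fsB[of 0]] \<nu>(2)[of 0] by simp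
    obtain f r where f: "f holomorphic_on unit_disc" and r: "strict_mono (r :: nat \<Rightarrow> nat)"
      and pt: "\<And>z. z \<in> unit_disc \<Longrightarrow> (\<lambda>n. fs (r n) z) \<longlonglongrightarrow> f z"
      and unif: "\<And>K. compact K \<Longrightarrow> K \<subseteq> unit_disc \<Longrightarrow> uniform_limit K (fs \<circ> r) f sequentially"
    proof (rule Montel[of unit_disc "range fs" fs])
      fix K assume K: "compact K" "K \<subseteq> unit_disc"
      \<comment> \<open>Local boundedness for Montel's theorem: positivity and continuity of
        \<open>\<nu>\<close> bound \<open>B / \<nu>\<close> on each compact set.\<close>
      have "continuous_on K (\<lambda>z. B / \<nu> z)"
        using K(2) \<nu>(2) by (intro continuous_intros continuous_on_subset[OF weightD(1)[OF \<nu>(1)] K(2)]) force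
      then have "bounded ((\<lambda>z. B / \<nu> z) ` K)"
        by (rule compact_imp_bounded[OF compact_continuous_image[OF _ K(1)]])
      then obtain b where b: "\<And>z. z \<in> K \<Longrightarrow> norm (B / \<nu> z) \<le> b" unfolding bounded_iff by blast
      show "\<exists>b. \<forall>h\<in>range fs. \<forall>z\<in>K. cmod (h z) \<le> b"
      proof (rule exI[of _ b], safe)
        fix n z assume z: "z \<in> K"
        then have zd: "z \<in> unit_disc" using K by blast
        have "cmod (fs n z) \<le> B / \<nu> z" using fsB[OF zd, of n] \<nu>(2)[OF zd] by (simp add: field_simps)
        also have "\<dots> \<le> b" using b[OF z] unfolding real_norm_def by (rule order_trans[OF abs_ge_self])
        finally show "cmod (fs n z) \<le> b" .
      qed
    qed (use fs in auto)
    \<comment> \<open>The bound passes to the pointwise limit, so \<open>Tg g f\<close> lies in the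
      target space and can serve as the limit function.\<close>
    have fB: "\<nu> z * cmod (f z) \<le> B" if z: "z \<in> unit_disc" for z
    proof (rule LIMSEQ_le_const2)
      show "(\<lambda>n. \<nu> z * cmod (fs (r n) z)) \<longlonglongrightarrow> \<nu> z * cmod (f z)"
        by (intro tendsto_intros pt z)
    qed (use fsB[OF z] in auto)
    have hf: "Tg g f \<in> Hinf \<mu>" by (rule bounded[OF f fB])
    have hfs: "Tg g (fs n) \<in> Hinf \<mu>" for n by (rule bounded[OF fs fsB])
    have "(\<lambda>k. Hinf_norm \<mu> (\<lambda>z. Tg g (fs (r k)) z - Tg g f z)) \<longlonglongrightarrow> 0"
    proof (rule LIMSEQ_I)
      fix e :: real assume e: "0 < e"
      \<comment> \<open>With \<open>a\<close> below, the two error terms are at most e/2 and e/4,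
        since the differences satisfy the bound \<open>2 * B\<close>; the summands 1 in the
        denominators cover vanishing constants.\<close>
      define \<epsilon> where "\<epsilon> = e / (4 * (B + 1))"
      have \<epsilon>: "\<epsilon> > 0" using e B0 by (simp add: \<epsilon>_def)
      obtain s t where st: "0 \<le> s" "s \<le> t" "t < 1" "\<And>r. t < r \<Longrightarrow> r < 1 \<Longrightarrow> Phi g \<nu> \<mu> r s \<le> \<epsilon>"
        using cutoff[OF \<epsilon>] by auto
      obtain k where k0: "0 \<le> k" and k: "\<And>z. norm z \<le> t \<Longrightarrow> norm (deriv g z) \<le> k"
        using bounded_on_smaller_disc[OF cg st(3)] by metis
      have \<mu>0: "0 \<le> \<mu> 0" using weightD(2)[OF \<mu>, of 0] by simp
      define a where "a = e / (4 * (\<mu> 0 * k + 1))"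
      have a: "a > 0" using e \<mu>0 k0 by (simp add: a_def add_nonneg_pos)
      have "uniform_limit (cball 0 t) (fs \<circ> r) f sequentially" by (rule unif) (use st in auto)
      then obtain N where N: "\<And>n z. n \<ge> N \<Longrightarrow> norm z \<le> t \<Longrightarrow> cmod (fs (r n) z - f z) < a"
        using a unfolding uniform_limit_iff eventually_sequentially by (fastforce simp: dist_norm)
      have "norm (Hinf_norm \<mu> (\<lambda>z. Tg g (fs (r n)) z - Tg g f z) - 0) < e" if n: "n \<ge> N" for n
      proof -
        have d: "(\<lambda>z. fs (r n) z - f z) holomorphic_on unit_disc"
          by (intro holomorphic_intros fs f)
        have dB: "\<nu> z * cmod (fs (r n) z - f z) \<le> 2 * B" if z: "z \<in> unit_disc" for z
        proof -
          have "\<nu> z * cmod (fs (r n) z - f z) \<le> \<nu> z * (cmod (fs (r n) z) + cmod (f z))"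
            using \<nu>(2)[OF z] by (intro mult_left_mono norm_triangle_ineq4) simp
          also have "\<dots> \<le> 2 * B" using fsB[OF z, of "r n"] fB[OF z] by (simp add: distrib_left)
          finally show ?thesis .
        qed
        have ub: "\<mu> z * cmod (Tg g (fs (r n)) z - Tg g f z) \<le> \<mu> 0 * (a * k) + 2 * B * \<epsilon>" if z: "z \<in> unit_disc" for z
          unfolding Tg_diff[OF g fs f z, symmetric]
          by (rule Tg_weighted_bound[OF g \<nu> \<mu> d dB st(1-3) _ k st(4) _ z])
            (use \<epsilon> N[OF n] in \<open>auto simp: less_imp_le\<close>)
        have "Hinf_norm \<mu> (\<lambda>z. Tg g (fs (r n)) z - Tg g f z) \<le> \<mu> 0 * (a * k) + 2 * B * \<epsilon>"
          by (rule Hinf_norm_least[OF ub])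
        also have "\<mu> 0 * (a * k) \<le> e / 4"
        proof -
          have "\<mu> 0 * (a * k) = (\<mu> 0 * k) / (\<mu> 0 * k + 1) * (e / 4)" by (simp add: a_def mult_ac)
          also have "\<dots> \<le> 1 * (e / 4)" using e mult_nonneg_nonneg[OF \<mu>0 k0] by (intro mult_right_mono) auto
          finally show ?thesis by simp
        qed
        also have "2 * B * \<epsilon> \<le> e / 2"
        proof -
          have "2 * B * \<epsilon> = B / (B + 1) * (e / 2)" using B0 by (simp add: \<epsilon>_def divide_simps)
          also have "\<dots> \<le> 1 * (e / 2)" using e B0 by (intro mult_right_mono) auto
          finally show ?thesis by simp
        qed
        finally have "Hinf_norm \<mu> (\<lambda>z. Tg g (fs (r n)) z - Tg g f z) < e" using e by simp
        \<comment> \<open>A real supremum is known to be nonnegative only once the set is bounded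
          above; hence both images must be in \<open>Hinf \<mu>\<close>.\<close>
        moreover have "0 \<le> Hinf_norm \<mu> (\<lambda>z. Tg g (fs (r n)) z - Tg g f z)"
          using Hinf_norm_upper[OF Hinf_diff[OF \<mu> hfs hf], of 0] by simp
        ultimately show ?thesis by simp
      qed
      then show "\<exists>no. \<forall>n\<ge>no. norm (Hinf_norm \<mu> (\<lambda>z. Tg g (fs (r n)) z - Tg g f z) - 0) < e" by blast
    qed
    then show "\<exists>r h. strict_mono r \<and> h \<in> Hinf \<mu> \<and>
        (\<lambda>k. Hinf_norm \<mu> (\<lambda>z. Tg g (fs (r k)) z - h z)) \<longlonglongrightarrow> 0"
      using r hf by blast
  qed
qed

subsection \<open>Necessity\<close>

text \<open>The product equation excludes zeros of \<open>\<nu>\<close> and identifies F(|z|) with 1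
  / \<nu>; domination by that value then forces it to be nonnegative, hence \<open>\<nu>\<close> to
  be positive.\<close>

lemma analytic_weightE:
  assumes "analytic_weight \<nu>"
  obtains F where "F holomorphic_on unit_disc"
    and "\<And>z. z \<in> unit_disc \<Longrightarrow> 0 < \<nu> z"
    and "\<And>z. z \<in> unit_disc \<Longrightarrow> F (of_real (norm z)) = of_real (1 / \<nu> z)"
    and "\<And>z. z \<in> unit_disc \<Longrightarrow> cmod (F z) \<le> 1 / \<nu> z"
proof -
  obtain F where F: "F holomorphic_on unit_disc"
    and 1: "\<And>z. z \<in> unit_disc \<Longrightarrow> complex_of_real (\<nu> z) * F (complex_of_real (norm z)) = 1"
    and 2: "\<And>z. z \<in> unit_disc \<Longrightarrow> cmod (F z) \<le> Re (F (complex_of_real (norm z)))"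
    using assms unfolding analytic_weight_def by blast
  have 3: "F (of_real (norm z)) = of_real (1 / \<nu> z)" if "z \<in> unit_disc" for z
  proof -
    have "complex_of_real (\<nu> z) \<noteq> 0" using 1[OF that] by auto
    then show ?thesis using 1[OF that] by (simp add: eq_divide_eq mult.commute)
  qed
  have 4: "cmod (F z) \<le> 1 / \<nu> z" if "z \<in> unit_disc" for z
    using 2[OF that] 3[OF that] by simp
  have "0 < \<nu> z" if "z \<in> unit_disc" for z
  proof -
    have "0 \<le> 1 / \<nu> z" using 4[OF that] by (rule order_trans[OF norm_ge_zero])
    moreover have "\<nu> z \<noteq> 0" using 1[OF that] by auto
    ultimately show ?thesis by (simp add: zero_le_divide_iff)
  qed
  then show ?thesis using that F 3 4 by blast
qed

text \<open>The function is a product of three factors: the rotated \<open>F\<close> equals 1 /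
  \<nu> on the ray while \<open>\<nu>\<close> times its modulus is at most 1 on the disc,
  \<open>u\<close> turns \<open>deriv g\<close> so that at least half its modulus becomes real part,
  and the rotated power contributes r^n on the ray and decay inside the disc. The constant is
  uniform in all parameters, including \<open>n\<close>.\<close>

lemma test_functions:
  assumes g: "g holomorphic_on unit_disc" and lg: "log_deriv_bloch g"
    and \<nu>: "weight \<nu>" "analytic_weight \<nu>"
  shows "\<exists>M. \<forall>\<theta> s t n. 0 \<le> s \<longrightarrow> s \<le> t \<longrightarrow> t < 1 \<longrightarrow> (\<exists>f. f holomorphic_on unit_disc
     \<and> (\<forall>z\<in>unit_disc. \<nu> z * cmod (f z) \<le> M * norm z ^ n)
     \<and> s ^ n / 2 * integral {s..t} (\<lambda>r. cmod (deriv g (of_real r * cis \<theta>)) / \<nu> (of_real r))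
        \<le> cmod (Tg g f (of_real t * cis \<theta>)))"
proof -
  obtain F where F: "F holomorphic_on unit_disc"
    and pos: "\<And>z. z \<in> unit_disc \<Longrightarrow> 0 < \<nu> z"
    and F1: "\<And>z. z \<in> unit_disc \<Longrightarrow> F (of_real (norm z)) = of_real (1 / \<nu> z)"
    and F2: "\<And>z. z \<in> unit_disc \<Longrightarrow> cmod (F z) \<le> 1 / \<nu> z"
    using analytic_weightE[OF \<nu>(2)] by metis
  obtain L where "L \<in> bloch" and L: "\<And>z. z \<in> unit_disc \<Longrightarrow> exp (L z) = deriv g z"
    using lg unfolding log_deriv_bloch_def by blast
  obtain M where M: "\<And>\<theta> t. \<lbrakk>0 \<le> t; t < 1\<rbrakk> \<Longrightarrow> \<exists>f. f holomorphic_on unit_disc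
     \<and> (\<forall>z\<in>unit_disc. cmod (f z) \<le> M)
     \<and> (\<forall>r\<in>{0..t}. cmod (exp (L (of_real r * cis \<theta>))) / 2 \<le> Re (f (of_real r * cis \<theta>) * exp (L (of_real r * cis \<theta>))))"
    using bloch_bounded_conjugate_phase[OF \<open>L \<in> bloch\<close>] by metis
  show ?thesis
  proof (intro exI[of _ M] allI impI)
    fix \<theta> s t :: real and n :: nat assume st: "0 \<le> s" "s \<le> t" "t < 1"
    then have t: "0 \<le> t" by simp
    obtain u where u: "u holomorphic_on unit_disc" and uM: "\<And>z. z \<in> unit_disc \<Longrightarrow> cmod (u z) \<le> M"
      and uL: "\<And>r. r \<in> {0..t} \<Longrightarrow> cmod (exp (L (of_real r * cis \<theta>))) / 2 \<le> Re (u (of_real r * cis \<theta>) * exp (L (of_real r * cis \<theta>)))"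
      using M[OF t st(3), of \<theta>] by blast
    define f where "f = (\<lambda>z. (z * cis (- \<theta>)) ^ n * u z * F (z * cis (- \<theta>)))"
    have rot: "(\<lambda>z. F (z * cis (- \<theta>))) holomorphic_on unit_disc"
      by (rule holomorphic_on_compose_gen[OF _ F, unfolded o_def]) (auto intro!: holomorphic_intros simp: norm_mult)
    have f: "f holomorphic_on unit_disc" unfolding f_def by (intro holomorphic_intros u rot)
    have rad: "\<nu> (z * cis (- \<theta>)) = \<nu> z" if "z \<in> unit_disc" for z
      by (rule antisym; rule weightD(3)[OF \<nu>(1)]) (use that in \<open>auto simp: norm_mult\<close>)
    have fM: "\<nu> z * cmod (f z) \<le> M * norm z ^ n" if z: "z \<in> unit_disc" for z
    proof -
      have "cmod (F (z * cis (- \<theta>))) \<le> 1 / \<nu> z"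
        using F2[of "z * cis (- \<theta>)"] rad[OF z] z by (simp add: norm_mult)
      then have "\<nu> z * cmod (F (z * cis (- \<theta>))) \<le> 1" using pos[OF z] by (simp add: field_simps)
      then have "norm z ^ n * cmod (u z) * (\<nu> z * cmod (F (z * cis (- \<theta>)))) \<le> norm z ^ n * M * 1"
        using uM[OF z] pos[OF z] order_trans[OF norm_ge_zero uM[OF z]] by (intro mult_mono) auto
      then show ?thesis by (simp add: f_def norm_mult norm_power mult_ac)
    qed
    define D where "D = (\<lambda>r. cmod (deriv g (of_real r * cis \<theta>)) / \<nu> (of_real r))"
    define \<phi> where "\<phi> = (\<lambda>r. Re (f (of_real r * cis \<theta>) * deriv g (of_real r * cis \<theta>)))"
    have low: "r ^ n / 2 * D r \<le> \<phi> r" if r: "r \<in> {0..t}" for r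
    proof -
      have r1: "0 \<le> r" "r < 1" using r st by auto
      have p: "0 < \<nu> (of_real r)" using pos[of "of_real r"] r1 by simp
      have "of_real r * cis \<theta> * cis (- \<theta>) = complex_of_real r" by (simp add: mult.assoc cis_mult)
      moreover have "F (of_real r) = of_real (1 / \<nu> (of_real r))" using F1[of "of_real r"] r1 by simp
      ultimately have "f (of_real r * cis \<theta>) * deriv g (of_real r * cis \<theta>)
         = of_real (r ^ n / \<nu> (of_real r)) * (u (of_real r * cis \<theta>) * exp (L (of_real r * cis \<theta>)))"
        unfolding f_def L[OF cis_disc[OF r1]] by (simp only:) simp
      then have eq: "\<phi> r = r ^ n / \<nu> (of_real r) * Re (u (of_real r * cis \<theta>) * exp (L (of_real r * cis \<theta>)))"
        unfolding \<phi>_def by (simp only: Re_complex_of_real times_complex.sel Im_complex_of_real mult_zero_left diff_zero)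
      have "r ^ n / 2 * D r = r ^ n / \<nu> (of_real r) * (cmod (exp (L (of_real r * cis \<theta>))) / 2)"
        unfolding D_def L[OF cis_disc[OF r1]] by simp
      also have "\<dots> \<le> \<phi> r" unfolding eq using r1 p uL[OF r] by (intro mult_left_mono) auto
      finally show ?thesis .
    qed
    have D0: "0 \<le> D r" if "r \<in> {0..t}" for r
      using pos[of "of_real r"] that st by (auto simp: D_def)
    have \<phi>0: "0 \<le> \<phi> r" if "r \<in> {0..t}" for r
    proof -
      have "0 \<le> r ^ n / 2 * D r" using D0[OF that] that by simp
      then show ?thesis using low[OF that] by (rule order_trans)
    qed
    have "((\<lambda>r. f (of_real r * cis \<theta>) * deriv g (of_real r * cis \<theta>) * cis \<theta>) has_integral
      (Tg g f (of_real t * cis \<theta>) - Tg g f (of_real 0 * cis \<theta>))) {0..t}"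
      by (rule Tg_ray_has_integral[OF g f _ t st(3)]) simp
    \<comment> \<open>The factor \<open>cis \<theta>\<close> is the direction of the ray; once it is
      cancelled, the real part of the integrand is \<open>\<phi>\<close>.\<close>
    from has_integral_mult_left[OF this, of "cis (- \<theta>)"]
    have "((\<lambda>r. f (of_real r * cis \<theta>) * deriv g (of_real r * cis \<theta>)) has_integral
      Tg g f (of_real t * cis \<theta>) * cis (- \<theta>)) {0..t}" by (simp add: mult.assoc cis_mult)
    then have I: "(\<phi> has_integral Re (Tg g f (of_real t * cis \<theta>) * cis (- \<theta>))) {0..t}"
      unfolding \<phi>_def by (rule has_integral_Re)
    have cD: "continuous_on {s..t} D" unfolding D_def
      by (rule Phi_integrand_continuous[OF g \<nu>(1) pos st(1,3)])
    have "s ^ n / 2 * integral {s..t} D = integral {s..t} (\<lambda>r. s ^ n / 2 * D r)" by simp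
    also have "\<dots> \<le> integral {s..t} \<phi>"
    proof (rule integral_le)
      show "(\<lambda>r. s ^ n / 2 * D r) integrable_on {s..t}"
        by (intro integrable_continuous_real continuous_intros cD)
      show "\<phi> integrable_on {s..t}"
        by (rule integrable_subinterval_real[OF has_integral_integrable[OF I]]) (use st in auto)
      fix r assume r: "r \<in> {s..t}"
      then have "s ^ n / 2 * D r \<le> r ^ n / 2 * D r"
        using st D0[of r] by (intro mult_right_mono divide_right_mono power_mono) auto
      also have "\<dots> \<le> \<phi> r" using r st by (intro low) auto
      finally show "s ^ n / 2 * D r \<le> \<phi> r" .
    qed
    \<comment> \<open>Because \<open>\<phi>\<close> is nonnegative on the whole radius, the part
      below \<open>s\<close> cannot cancel what was gained on {s..t}.\<close>
    also have "\<dots> \<le> integral {0..t} \<phi>"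
      by (rule integral_subset_le)
        (use st \<phi>0 has_integral_integrable[OF I] integrable_subinterval_real[OF has_integral_integrable[OF I], of s t] in auto)
    also have "\<dots> = Re (Tg g f (of_real t * cis \<theta>) * cis (- \<theta>))" using I by (rule integral_unique)
    also have "\<dots> \<le> cmod (Tg g f (of_real t * cis \<theta>) * cis (- \<theta>))" by (rule complex_Re_le_cmod)
    also have "\<dots> = cmod (Tg g f (of_real t * cis \<theta>))" by (simp add: norm_mult)
    finally show "\<exists>f. f holomorphic_on unit_disc
     \<and> (\<forall>z\<in>unit_disc. \<nu> z * cmod (f z) \<le> M * norm z ^ n)
     \<and> s ^ n / 2 * integral {s..t} (\<lambda>r. cmod (deriv g (of_real r * cis \<theta>)) / \<nu> (of_real r))
        \<le> cmod (Tg g f (of_real t * cis \<theta>))"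
      using f fM unfolding D_def by blast
  qed
qed

text \<open>For fixed z, the functions are at most M |z|^n / \<nu>(z) on the closed disc through z,
  which decays geometrically. The pointwise limit later identifies the norm limit of a
  subsequence.\<close>

lemma Tg_tendsto_0:
  assumes g: "g holomorphic_on unit_disc" and \<nu>: "weight \<nu>" "\<And>z. z \<in> unit_disc \<Longrightarrow> 0 < \<nu> z"
    and fs: "\<And>n. fs n holomorphic_on unit_disc"
    and M: "\<And>n z. z \<in> unit_disc \<Longrightarrow> \<nu> z * cmod (fs n z) \<le> M * norm z ^ n"
    and z: "z \<in> unit_disc"
  shows "(\<lambda>n. Tg g (fs n) z) \<longlonglongrightarrow> 0"
proof -
  have M0: "0 \<le> M" using order_trans[OF _ M[of 0 0]] \<nu>(2)[of 0] by simp
  have z1: "norm z < 1" using z by simp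
  have "continuous_on unit_disc (deriv g)"
    using g by (intro holomorphic_on_imp_continuous_on holomorphic_deriv) auto
  then obtain k where k: "\<And>w. norm w \<le> norm z \<Longrightarrow> norm (deriv g w) \<le> k"
    using bounded_on_smaller_disc z1 by metis
  have bound: "norm (Tg g (fs n) z) \<le> M * norm z ^ n / \<nu> z * k" for n
  proof (rule norm_Tg_le[OF g fs z1 _ k order_refl])
    fix w :: complex assume w: "norm w \<le> norm z"
    then have wd: "w \<in> unit_disc" using z1 by simp
    have "cmod (fs n w) \<le> M * norm w ^ n / \<nu> w" using M[OF wd, of n] \<nu>(2)[OF wd] by (simp add: field_simps)
    also have "\<dots> \<le> M * norm z ^ n / \<nu> z"
      using w M0 \<nu>(2)[OF z] weightD(3)[OF \<nu>(1) z w] by (intro frac_le mult_left_mono power_mono) auto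
    finally show "cmod (fs n w) \<le> M * norm z ^ n / \<nu> z" .
  qed
  have "(\<lambda>n. norm z ^ n) \<longlonglongrightarrow> 0" by (rule LIMSEQ_power_zero) (use z1 in simp)
  then have "(\<lambda>n. M * norm z ^ n / \<nu> z * k) \<longlonglongrightarrow> M * 0 / \<nu> z * k"
    using \<nu>(2)[OF z] by (intro tendsto_mult tendsto_divide tendsto_const) auto
  then have "(\<lambda>n. M * norm z ^ n / \<nu> z * k) \<longlonglongrightarrow> 0" by simp
  then show ?thesis
    by (rule Lim_null_comparison[OF always_eventually[OF allI[OF bound]]])
qed

lemma Phi_tendsto_0_if_Tg_compact:
  assumes g: "g holomorphic_on unit_disc" and lg: "log_deriv_bloch g"
    and \<nu>: "weight \<nu>" "analytic_weight \<nu>" and \<mu>: "weight \<mu>"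
    and compact: "Tg_compact g \<nu> \<mu>"
  shows "((\<lambda>t2. Limsup (at_left 1) (\<lambda>t1. ereal (Phi g \<nu> \<mu> t1 t2))) \<longlongrightarrow> 0) (at_left (1::real))"
proof (rule order_tendstoI)
  have pos: "\<And>z. z \<in> unit_disc \<Longrightarrow> 0 < \<nu> z" using analytic_weightE[OF \<nu>(2)] by metis
  \<comment> \<open>Nonnegativity of \<open>Phi\<close> settles the lower half of the convergence;
    only the upper half uses compactness.\<close>
  have ge0: "0 \<le> Limsup (at_left 1) (\<lambda>t. ereal (Phi g \<nu> \<mu> t s))" if s: "s \<in> {0<..<1}" for s
  proof (rule le_Limsup)
    show "\<forall>\<^sub>F t in at_left 1. 0 \<le> ereal (Phi g \<nu> \<mu> t s)"
      by (rule eventually_mono[OF eventually_at_left_real[of s 1]]) (use s in \<open>auto intro!: Phi_nonneg[OF g \<nu>(1) pos \<mu>]\<close>)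
  qed simp
  show "\<forall>\<^sub>F s in at_left 1. a < Limsup (at_left 1) (\<lambda>t. ereal (Phi g \<nu> \<mu> t s))" if "a < 0" for a
    by (rule eventually_mono[OF eventually_at_left_real[OF zero_less_one]]) (rule less_le_trans[OF that ge0])
  obtain M where M: "\<And>\<theta> s t n. \<lbrakk>0 \<le> s; s \<le> t; t < 1\<rbrakk> \<Longrightarrow> \<exists>f. f holomorphic_on unit_disc
     \<and> (\<forall>z\<in>unit_disc. \<nu> z * cmod (f z) \<le> M * norm z ^ n)
     \<and> s ^ n / 2 * integral {s..t} (\<lambda>r. cmod (deriv g (of_real r * cis \<theta>)) / \<nu> (of_real r))
        \<le> cmod (Tg g f (of_real t * cis \<theta>))"
    using test_functions[OF g lg \<nu>] by blast
  fix a :: ereal assume "0 < a"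
  then obtain \<epsilon> where \<epsilon>: "0 < \<epsilon>" "ereal \<epsilon> < a"
    using ereal_dense2[of 0 a] by (auto simp: zero_ereal_def)
  show "\<forall>\<^sub>F s in at_left 1. Limsup (at_left 1) (\<lambda>t. ereal (Phi g \<nu> \<mu> t s)) < a"
  proof (rule ccontr)
    assume neg: "\<not> ?thesis"
    \<comment> \<open>The order of choice matters: first n, then s so close to 1 that s^n > 1/2,
      then t and \<open>\<theta>\<close> witnessing a large value of \<open>Phi\<close>. The loss
      1/4 is this 1/2 times the 1/2 from the phase.\<close>
    have "\<exists>f z. f holomorphic_on unit_disc \<and> (\<forall>w\<in>unit_disc. \<nu> w * cmod (f w) \<le> M * norm w ^ n)
        \<and> z \<in> unit_disc \<and> \<epsilon> / 4 \<le> \<mu> z * cmod (Tg g f z)" for n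
    proof -
      have "((\<lambda>s::real. s ^ n) \<longlongrightarrow> 1 ^ n) (at_left 1)" by (intro tendsto_intros)
      then have "\<forall>\<^sub>F s::real in at_left 1. 1 / 2 < s ^ n" by (rule order_tendstoD) simp
      then have ev: "\<forall>\<^sub>F s::real in at_left 1. 1 / 2 < s ^ n \<and> s \<in> {0<..<1}"
        using eventually_at_left_real[of 0 1] by (intro eventually_conj) auto
      have "\<exists>s. 1 / 2 < s ^ n \<and> s \<in> {0<..<1} \<and> \<not> Limsup (at_left 1) (\<lambda>t. ereal (Phi g \<nu> \<mu> t s)) < a"
        using neg by (rule contrapos_np) (rule eventually_mono[OF ev], blast)
      then obtain s where sn: "1 / 2 < s ^ n" and s: "0 < s" "s < 1"
        and "\<not> Limsup (at_left 1) (\<lambda>t. ereal (Phi g \<nu> \<mu> t s)) < a" by auto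
      then have "\<not> Limsup (at_left 1) (\<lambda>t. ereal (Phi g \<nu> \<mu> t s)) \<le> ereal \<epsilon>"
        using \<epsilon>(2) by auto
      then have "\<not> (\<forall>\<^sub>F t in at_left 1. ereal (Phi g \<nu> \<mu> t s) \<le> ereal \<epsilon>)"
        by (rule contrapos_nn) (rule Limsup_bounded)
      then have "\<exists>t\<in>{s<..<1}. \<not> ereal (Phi g \<nu> \<mu> t s) \<le> ereal \<epsilon>"
        by (rule contrapos_np) (rule eventually_mono[OF eventually_at_left_real[OF s(2)]], blast)
      then obtain t where t: "s < t" "t < 1" and "\<epsilon> < Phi g \<nu> \<mu> t s" by auto
      then obtain \<theta> where \<theta>: "\<epsilon> < \<mu> (of_real t) *
          integral {s..t} (\<lambda>r. cmod (deriv g (of_real r * cis \<theta>)) / \<nu> (of_real r))" (is "_ < _ * ?I")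
        unfolding Phi_def using s t
        \<comment> \<open>Extracting a direction from the strict inequality requires the supremum to
          be over a bounded set.\<close>
        by (subst (asm) less_cSUP_iff[OF _ Phi_bdd_above[OF g \<nu>(1) pos \<mu>]]) auto
      obtain f where f: "f holomorphic_on unit_disc" "\<forall>w\<in>unit_disc. \<nu> w * cmod (f w) \<le> M * norm w ^ n"
        and fI: "s ^ n / 2 * ?I \<le> cmod (Tg g f (of_real t * cis \<theta>))"
        using M[of s t n \<theta>] s t by auto
      have t0: "0 \<le> t" using s t by simp
      have "1 / 4 * \<epsilon> \<le> s ^ n / 2 * (\<mu> (of_real t) * ?I)"
        using sn \<theta> \<epsilon>(1) by (intro mult_mono) auto
      also have "\<dots> = \<mu> (of_real t) * (s ^ n / 2 * ?I)" by simp
      also have "\<dots> \<le> \<mu> (of_real t) * cmod (Tg g f (of_real t * cis \<theta>))"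
        using fI weight_polar(2)[OF \<mu> t0 t(2)] by (intro mult_left_mono)
      also have "\<mu> (of_real t) = \<mu> (of_real t * cis \<theta>)"
        using weight_polar(1)[OF \<mu> t0 t(2)] by simp
      finally have "\<epsilon> / 4 \<le> \<mu> (of_real t * cis \<theta>) * cmod (Tg g f (of_real t * cis \<theta>))" by simp
      then show ?thesis using f cis_disc[OF t0 t(2)] by blast
    qed
    then obtain fs zs where fs: "\<And>n. fs n holomorphic_on unit_disc"
      and fsM: "\<And>n w. w \<in> unit_disc \<Longrightarrow> \<nu> w * cmod (fs n w) \<le> M * norm w ^ n"
      and zs: "\<And>n. zs n \<in> unit_disc" and low: "\<And>n. \<epsilon> / 4 \<le> \<mu> (zs n) * cmod (Tg g (fs n) (zs n))"
      by metis
    have M0: "0 \<le> M" using order_trans[OF _ fsM[of 0 0]] pos[of 0] by simp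
    have fsB: "\<nu> w * cmod (fs n w) \<le> M" if w: "w \<in> unit_disc" for n w
      using fsM[OF w, of n] mult_left_le[of "norm w ^ n" M] M0 w by (simp add: power_le_one)
    have fsH: "fs n \<in> Hinf \<nu>" for n by (rule Hinf_intro[OF fs fsB])
    moreover have "Hinf_norm \<nu> (fs n) \<le> M" for n by (rule Hinf_norm_least[OF fsB])
    ultimately obtain r h where r: "strict_mono (r :: nat \<Rightarrow> nat)" and h: "h \<in> Hinf \<mu>"
      and conv: "(\<lambda>k. Hinf_norm \<mu> (\<lambda>z. Tg g (fs (r k)) z - h z)) \<longlonglongrightarrow> 0"
      using compact[unfolded Tg_compact_def, THEN conjunct2, THEN spec[of _ fs], THEN spec[of _ M]] by blast
    have T: "Tg g (fs n) \<in> Hinf \<mu>" for n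
      using compact[unfolded Tg_compact_def, THEN conjunct1] fsH by blast
    have up: "\<mu> z * cmod (Tg g (fs (r k)) z - h z) \<le> Hinf_norm \<mu> (\<lambda>z. Tg g (fs (r k)) z - h z)"
      if "z \<in> unit_disc" for z k
      by (rule Hinf_norm_upper[OF Hinf_diff[OF \<mu> T h] that])
    \<comment> \<open>\<open>\<mu>\<close> may vanish somewhere, so the conclusion is that the
      product is 0, not that \<open>h\<close> is.\<close>
    have h0: "\<mu> z * cmod (h z) = 0" if z: "z \<in> unit_disc" for z
    proof -
      have "(\<lambda>n. Tg g (fs n) z) \<longlonglongrightarrow> 0"
        by (rule Tg_tendsto_0[OF g \<nu>(1) pos fs fsM z])
      then have "(\<lambda>k. Tg g (fs (r k)) z) \<longlonglongrightarrow> 0"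
        using LIMSEQ_subseq_LIMSEQ[OF _ r] by (auto simp: o_def)
      then have "(\<lambda>k. \<mu> z * cmod (Tg g (fs (r k)) z - h z)) \<longlonglongrightarrow> \<mu> z * cmod (0 - h z)"
        by (intro tendsto_intros)
      then have "\<mu> z * cmod (0 - h z) \<le> 0"
        by (rule LIMSEQ_le[OF _ conv]) (use up[OF z] in blast)
      moreover have "0 \<le> \<mu> z * cmod (h z)" using weightD(2)[OF \<mu> z] by simp
      ultimately show ?thesis by simp
    qed
    have "\<forall>\<^sub>F k in sequentially. Hinf_norm \<mu> (\<lambda>z. Tg g (fs (r k)) z - h z) < \<epsilon> / 4"
      by (rule order_tendstoD(2)[OF conv]) (use \<epsilon> in simp)
    then obtain k where k: "Hinf_norm \<mu> (\<lambda>z. Tg g (fs (r k)) z - h z) < \<epsilon> / 4"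
      using eventually_happens'[OF sequentially_bot] by blast
    define z where "z = zs (r k)"
    have z: "z \<in> unit_disc" using zs by (simp add: z_def)
    \<comment> \<open>At the chosen point the image is bounded below by construction, yet the norm
      of its difference from \<open>h\<close> is smaller and \<open>h\<close> has no weighted
      size.\<close>
    have "\<epsilon> / 4 \<le> \<mu> z * cmod (Tg g (fs (r k)) z)" using low[of "r k"] by (simp add: z_def)
    also have "\<dots> \<le> \<mu> z * (cmod (Tg g (fs (r k)) z - h z) + cmod (h z))"
      using weightD(2)[OF \<mu> z] by (intro mult_left_mono) (metis add.commute norm_triangle_sub)
    also have "\<dots> < \<epsilon> / 4" unfolding distrib_left h0[OF z] using up[OF z, of k] k by linarith
    finally show False by simp
  qed
qed

theorem theorem7:
  fixes g :: "complex \<Rightarrow> complex" and \<nu> \<mu> :: "complex \<Rightarrow> real"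
  assumes "g holomorphic_on unit_disc"
    and "log_deriv_bloch g"
    and "weight \<nu>" and "analytic_weight \<nu>"
    and "weight \<mu>"
  shows "Tg_compact g \<nu> \<mu> \<longleftrightarrow>
    ((\<lambda>t2. Limsup (at_left 1) (\<lambda>t1. ereal (Phi g \<nu> \<mu> t1 t2))) \<longlongrightarrow> 0) (at_left (1::real))"
proof -
  obtain pos: "\<And>z. z \<in> unit_disc \<Longrightarrow> 0 < \<nu> z"
    using analytic_weightE[OF assms(4)] by metis
  show ?thesis
    using Phi_tendsto_0_if_Tg_compact[OF assms]
      Tg_compact_if_Phi_tendsto_0[OF assms(1,3) pos assms(5)] by blast
qed

end
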